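(* Let $\frac{r}{s}>1$ be a rational number, let $\left[\frac{r}{s}\right]_q=\frac{\mathcal{R}(q)}{\mathcal{S}(q)}$ be the corresponding $q$-rational, and let $\frac{r}{s}=[a_1,a_2,\ldots,a_{2m}]$ be its continued fraction expansion with an even number of coefficients (all $a_i\geq 1$ integers). Let $\mathcal{G}_{\frac{r}{s}}$ be the snake graph of $\frac{r}{s}$ with its edge weights, let $\mathcal{M}_q(\mathcal{G}_{\frac{r}{s}})$ be its weighted number of perfect matchings, and set $n:=a_2+a_4+\cdots+a_{2m}-1$. Then $$\mathcal{R}(q)=q^{n}\,\mathcal{M}_q\big(\mathcal{G}_{\frac{r}{s}}\big).$$
   Context: **Continued fractions.** $[a_1,\ldots,a_k]$ denotes $a_1+\cfrac{1}{a_2+\cfrac{1}{\ddots+\cfrac{1}{a_k}}}$ with integers $a_i\ge 1$. Every rational number $>1$ has exactly one such expansion with $k$ even, and exactly one with $k$ odd; they are related by $[a_1,\ldots,a_k,1]=[a_1,\ldots,a_k+1]$. **$q$-rationals.** Let $q$ be a formal variable. For an integer $a\ge1$ put $[a]_q=1+q+\cdots+q^{a-1}$ and $[a]_{q^{-1}}=1+q^{-1}+\cdots+q^{-(a-1)}$. For $\frac rs=[a_1,\ldots,a_k]>1$ the $q$-rational is the rational function $$\left[\frac{r}{s}\right]_{q}:=[a_1]_{q} + \cfrac{q^{a_{1}}}{[a_2]_{q^{-1}} + \cfrac{q^{-a_{2}}}{[a_{3}]_{q} +\cfrac{q^{a_{3}}}{[a_{4}]_{q^{-1}}+ \cfrac{q^{-a_{4}}}{\ddots}}}},$$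 ending with $[a_k]_q$ if $k$ is odd and with $[a_k]_{q^{-1}}$ if $k$ is even; that is, odd-indexed coefficients appear as $[a_i]_q$ followed by numerator $q^{a_i}$, and even-indexed ones as $[a_i]_{q^{-1}}$ followed by numerator $q^{-a_i}$. It does not depend on the choice of the expansion. It is written as an irreducible fraction $\frac{\mathcal{R}(q)}{\mathcal{S}(q)}$, where $\mathcal{R},\mathcal{S}$ are coprime monic polynomials in $q$ with positive integer coefficients. **Snake graph $\mathcal{G}_{\frac rs}$.** A snake graph is a plane graph formed by unit square boxes $B_1,\ldots,B_d$ of the grid $\mathbb{Z}^2$, together with their vertices and edges, where $B_1$ has lower-left corner $(0,0)$ and each $B_{t+1}$ is glued to $B_t$ either along the east edge of $B_t$ (attached at the right) or along the north edge of $B_t$ (attached on the top). Label edges of boxes by signs as follows: the south and east edges of $B_1$ get $-$ and its north edge gets $+$; and in every box the north and west edges have the same sign, the south and east edges have the same sign, and the north and south edges have opposite signs. The sign sequence of the snake graph starts with the sign $-$ of the south edge of $B_1$, continues with the signs of the $d-1$ edges shared by consecutive boxes $B_t,B_{t+1}$ in order, and ends with the sign of either the north or the east edge of $B_d$ (one chooses which one). For $\frac rs=[a_1,\ldots,a_k]$, $\mathcal{G}_{\frac rs}$ is the snake graph whose sign sequence (for a suitable choice of the last edge) consists of $a_1$ signs $-$, then $a_2$ signs $+$, then $a_3$ signs $-$, and so on, alternating up to $a_k$ equal signs. It has $d=a_1+\cdots+a_k-1$ boxes and does not depend on which of the two expansions of $\frac rs$ is used. **Weights.** An edge on the western (respectively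 southern) border of the snake graph is an edge that belongs to exactly one box and is the west (respectively south) edge of that box. Weights of edges of the snake graph are: - an edge of the western border joining $(x,y)$ to $(x,y+1)$ has weight $q$ ("blue") if $x+y$ is even and $q^{-1}$ ("red") if $x+y$ is odd; - an edge of the southern border joining $(x,y)$ to $(x+1,y)$ with $x\ge1$ has weight $q$ ("blue") if $x+y$ is odd and $q^{-1}$ ("red") if $x+y$ is even; - all other edges (including the horizontal edges joining $(0,y)$ to $(1,y)$, all edges shared by two boxes, and the eastern and northern borders) are uncolored and have weight $1$. **Perfect matchings.** A perfect matching $\mathfrak m$ of a graph is a set of edges such that every vertex belongs to exactly one edge of $\mathfrak m$. Its weight $\mathrm{wt}(\mathfrak m)$ is the product of the weights of its edges, and $\mathcal{M}_q(\mathcal{G}):=\sum_{\mathfrak m}\mathrm{wt}(\mathfrak m)$, the sum being over all perfect matchings of $\mathcal{G}$. *)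

theory Defs
  imports "HOL-Computational_Algebra.Computational_Algebra"
begin

subsection \<open>Continued fractions\<close>

fun cf_value :: "nat list \<Rightarrow> rat" where
  "cf_value [] = 0"
| "cf_value [a] = of_nat a"
| "cf_value (a # b # as) = of_nat a + 1 / cf_value (b # as)"

definition cf_expansion :: "rat \<Rightarrow> nat list \<Rightarrow> bool" where
  "cf_expansion x as \<longleftrightarrow> as \<noteq> [] \<and> (\<forall>a\<in>set as. a \<ge> 1) \<and> cf_value as = x"


subsection \<open>The \<open>q\<close>-rationals\<close>

text \<open>Rational functions in \<open>q\<close> are elements of the fraction field of \<open>\<int>[q]\<close>.\<close>

definition qvar :: "int poly fract" where
  "qvar = to_fract [:0, 1:]"

definition q_int :: "int poly fract \<Rightarrow> nat \<Rightarrow> int poly fract" where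
  "q_int p a = (\<Sum>i<a. p ^ i)"

text \<open>The parameter \<open>p\<close> alternates between \<open>q\<close> (odd-indexed coefficients) and its inverse
  (even-indexed coefficients).\<close>

fun q_cf :: "int poly fract \<Rightarrow> nat list \<Rightarrow> int poly fract" where
  "q_cf p [] = 0"
| "q_cf p [a] = q_int p a"
| "q_cf p (a # b # as) = q_int p a + p ^ a / q_cf (inverse p) (b # as)"

text \<open>The value does not depend on which of the two expansions of \<open>x > 1\<close> is used.\<close>

definition q_rational :: "rat \<Rightarrow> int poly fract" where
  "q_rational x = (THE v. \<exists>as. cf_expansion x as \<and> v = q_cf qvar as)"


subsection \<open>Snake graphs\<close>

text \<open>A box is given by its lower-left corner, an edge by the set of its two endpoints, and a
  snake graph by the list of its boxes.\<close>

type_synonym vertex = "int \<times> int"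
type_synonym edge = "vertex set"
type_synonym box = "int \<times> int"

fun south :: "box \<Rightarrow> edge" where "south (x, y) = {(x, y), (x + 1, y)}"
fun north :: "box \<Rightarrow> edge" where "north (x, y) = {(x, y + 1), (x + 1, y + 1)}"
fun west :: "box \<Rightarrow> edge" where "west (x, y) = {(x, y), (x, y + 1)}"
fun east :: "box \<Rightarrow> edge" where "east (x, y) = {(x + 1, y), (x + 1, y + 1)}"

definition box_edges :: "box \<Rightarrow> edge set" where
  "box_edges b = {south b, north b, west b, east b}"

definition attached_right :: "box \<Rightarrow> box \<Rightarrow> bool" where
  "attached_right b c \<longleftrightarrow> c = (fst b + 1, snd b)"

definition attached_top :: "box \<Rightarrow> box \<Rightarrow> bool" where
  "attached_top b c \<longleftrightarrow> c = (fst b, snd b + 1)"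

definition is_snake :: "box list \<Rightarrow> bool" where
  "is_snake bs \<longleftrightarrow> bs \<noteq> [] \<and> hd bs = (0, 0) \<and>
     (\<forall>t. Suc t < length bs \<longrightarrow>
        attached_right (bs ! t) (bs ! Suc t) \<or> attached_top (bs ! t) (bs ! Suc t))"

definition snake_edges :: "box list \<Rightarrow> edge set" where
  "snake_edges bs = (\<Union>b\<in>set bs. box_edges b)"

definition snake_vertices :: "box list \<Rightarrow> vertex set" where
  "snake_vertices bs = \<Union>(snake_edges bs)"


subsection \<open>Sign sequences\<close>

datatype edge_sign = Minus | Plus

definition sign_labelling :: "box list \<Rightarrow> (edge \<Rightarrow> edge_sign) \<Rightarrow> bool" where
  "sign_labelling bs \<sigma> \<longleftrightarrow>
     \<sigma> (south (hd bs)) = Minus \<and> \<sigma> (east (hd bs)) = Minus \<and> \<sigma> (north (hd bs)) = Plus \<and>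
     (\<forall>b\<in>set bs. \<sigma> (north b) = \<sigma> (west b) \<and> \<sigma> (south b) = \<sigma> (east b) \<and> \<sigma> (north b) \<noteq> \<sigma> (south b))"

definition shared_edge :: "box \<Rightarrow> box \<Rightarrow> edge" where
  "shared_edge b c = (if attached_right b c then east b else north b)"

definition sign_sequence :: "box list \<Rightarrow> (edge \<Rightarrow> edge_sign) \<Rightarrow> edge \<Rightarrow> edge_sign list" where
  "sign_sequence bs \<sigma> e =
     [\<sigma> (south (hd bs))] @
     map (\<lambda>t. \<sigma> (shared_edge (bs ! t) (bs ! Suc t))) [0..<length bs - 1] @
     [\<sigma> e]"

definition cf_signs :: "nat list \<Rightarrow> edge_sign list" where
  "cf_signs as =
     concat (map (\<lambda>i. replicate (as ! i) (if even i then Minus else Plus)) [0..<length as])"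

definition is_snake_of :: "nat list \<Rightarrow> box list \<Rightarrow> bool" where
  "is_snake_of as bs \<longleftrightarrow> is_snake bs \<and>
     (\<exists>\<sigma> e. sign_labelling bs \<sigma> \<and> e \<in> {north (last bs), east (last bs)} \<and>
        sign_sequence bs \<sigma> e = cf_signs as)"

text \<open>The snake graph does not depend on which of the two expansions of \<open>x > 1\<close> is used.\<close>

definition snake_graph :: "rat \<Rightarrow> box list" where
  "snake_graph x = (THE bs. \<exists>as. cf_expansion x as \<and> is_snake_of as bs)"


subsection \<open>Weighted perfect matchings\<close>

definition boxes_at :: "box list \<Rightarrow> edge \<Rightarrow> box set" where
  "boxes_at bs e = {b \<in> set bs. e \<in> box_edges b}"

definition western_border :: "box list \<Rightarrow> edge \<Rightarrow> box \<Rightarrow> bool" where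
  "western_border bs e b \<longleftrightarrow> boxes_at bs e = {b} \<and> e = west b"

definition southern_border :: "box list \<Rightarrow> edge \<Rightarrow> box \<Rightarrow> bool" where
  "southern_border bs e b \<longleftrightarrow> boxes_at bs e = {b} \<and> e = south b"

definition blue :: "box list \<Rightarrow> edge \<Rightarrow> bool" where
  "blue bs e \<longleftrightarrow>
     (\<exists>x y. western_border bs e (x, y) \<and> even (x + y)) \<or>
     (\<exists>x y. southern_border bs e (x, y) \<and> x \<ge> 1 \<and> odd (x + y))"

definition red :: "box list \<Rightarrow> edge \<Rightarrow> bool" where
  "red bs e \<longleftrightarrow>
     (\<exists>x y. western_border bs e (x, y) \<and> odd (x + y)) \<or>
     (\<exists>x y. southern_border bs e (x, y) \<and> x \<ge> 1 \<and> even (x + y))"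

definition edge_weight :: "box list \<Rightarrow> edge \<Rightarrow> int poly fract" where
  "edge_weight bs e = (if blue bs e then qvar else if red bs e then inverse qvar else 1)"

definition perfect_matching :: "'v set \<Rightarrow> 'v set set \<Rightarrow> 'v set set \<Rightarrow> bool" where
  "perfect_matching V E M \<longleftrightarrow> M \<subseteq> E \<and> (\<forall>v\<in>V. \<exists>!e. e \<in> M \<and> v \<in> e)"

definition matching_weight :: "box list \<Rightarrow> edge set \<Rightarrow> int poly fract" where
  "matching_weight bs M = (\<Prod>e\<in>M. edge_weight bs e)"

definition matching_sum :: "box list \<Rightarrow> int poly fract" where
  "matching_sum bs =
     (\<Sum>M | perfect_matching (snake_vertices bs) (snake_edges bs) M. matching_weight bs M)"

end

theory Submission
  imports Defs
begin

text \<open>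
  Both sides of the identity are computed by the same two-dimensional linear recursion, driven by
  the sign sequence that encodes the continued fraction.

  On the combinatorial side, the snake is grown box by box. The north-east corner of the last box
  is matched either through the north or through the east edge of that box, so the matching sum is
  \<open>u + v\<close>, where \<open>u\<close> and \<open>v\<close> are the matching sums after removing the endpoints of the edge of
  sign \<open>Minus\<close> and of the edge of sign \<open>Plus\<close> among these two. Gluing the next box along an edge of
  sign \<open>Minus\<close> turns \<open>(u, v)\<close> into \<open>(q u, u + v)\<close>, and gluing along an edge of sign \<open>Plus\<close> turns
  it into \<open>(u + v, v / q)\<close> (lemma \<open>sign_step_matching_sums\<close>). The coloring rule is exactly what
  makes this uniform: whichever way the next box is attached, its new western or southern border
  edge has weight \<open>q\<close> if the glued edge has sign \<open>Minus\<close>, and \<open>1 / q\<close> if it has sign \<open>Plus\<close>.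

  On the continued fraction side, a block of \<open>a\<close> equal signs is a power of one of the two
  unipotent-times-diagonal matrices above, whose nontrivial entries are a \<open>q\<close>-integer and a power of \<open>q\<close>.
  Processing the blocks of an even expansion therefore multiplies the matrices of the continued
  fraction, and the first coordinate of the result depends on the initial vector \<open>(u, v)\<close> as
  \<open>P u + Q v\<close> up to a power of \<open>q\<close>, where \<open>P / Q\<close> is the \<open>q\<close>-rational (lemmas
  \<open>fold_sign_step_eq_continuant_polys\<close> and \<open>q_cf_eq_continuant_polys\<close>). The start vector of the
  snake is \<open>(1, 0)\<close>, which selects \<open>P\<close>.

  It remains to see that \<open>P\<close> is the reduced monic numerator. The matrices have determinants that
  are powers of \<open>q\<close>, so a common divisor of \<open>P\<close> and \<open>Q\<close> divides a power of \<open>q\<close>; as both have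
  constant term 1, they are coprime. Finally, the \<open>q\<close>-rational and the snake graph are defined
  by unique choice over all expansions, so it has to be known that the only ambiguity is
  \<open>[\<dots>, a, 1] = [\<dots>, a + 1]\<close>, which changes only the last sign.
\<close>

section \<open>Weighted perfect matchings of induced subgraphs\<close>

text \<open>Only edges with both endpoints in \<open>V\<close> are used: this is the matching sum of the subgraph induced
on \<open>V\<close>. Removing vertices from a graph is then a change of \<open>V\<close> alone, with the edge set and
the weights of the whole graph kept fixed.\<close>
definition matching_sum_on :: "('v set \<Rightarrow> 'a::comm_semiring_1) \<Rightarrow> 'v set set \<Rightarrow> 'v set \<Rightarrow> 'a" where
  "matching_sum_on w E V = (\<Sum>M | perfect_matching V {e \<in> E. e \<subseteq> V} M. prod w M)"

lemma matching_sum_eq_matching_sum_on: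
  "matching_sum bs = matching_sum_on (edge_weight bs) (snake_edges bs) (snake_vertices bs)"
proof -
  have "{e \<in> snake_edges bs. e \<subseteq> snake_vertices bs} = snake_edges bs"
    by (auto simp: snake_vertices_def)
  then show ?thesis
    by (simp add: matching_sum_def matching_sum_on_def matching_weight_def)
qed

lemma matching_sum_on_empty:
  assumes "{} \<notin> E"
  shows "matching_sum_on w E {} = 1"
proof -
  have "{M. perfect_matching {} {e \<in> E. e \<subseteq> {}} M} = {{}}"
    using assms by (auto simp: perfect_matching_def)
  then show ?thesis by (simp add: matching_sum_on_def)
qed

lemma matching_insert:
  assumes "e \<in> E" "e \<subseteq> V" and M: "perfect_matching (V - e) {f \<in> E. f \<subseteq> V - e} M"
  shows "perfect_matching V {f \<in> E. f \<subseteq> V} (insert e M)"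
  unfolding perfect_matching_def
proof (intro conjI ballI)
  show "insert e M \<subseteq> {f \<in> E. f \<subseteq> V}"
    using assms by (auto simp: perfect_matching_def)
  fix u assume u: "u \<in> V"
  show "\<exists>!f. f \<in> insert e M \<and> u \<in> f"
  proof (cases "u \<in> e")
    case True
    moreover have "u \<notin> f" if "f \<in> M" for f
      using that M True by (auto simp: perfect_matching_def)
    ultimately show ?thesis by auto
  next
    case False
    with u have "\<exists>!f. f \<in> M \<and> u \<in> f" using M by (auto simp: perfect_matching_def)
    with False show ?thesis by auto
  qed
qed

lemma matching_remove:
  assumes M: "perfect_matching V {f \<in> E. f \<subseteq> V} M" and e: "e \<in> M"
  shows "perfect_matching (V - e) {f \<in> E. f \<subseteq> V - e} (M - {e})"
  unfolding perfect_matching_def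
proof (intro conjI ballI)
  have uniq: "f = g" if "f \<in> M" "g \<in> M" "u \<in> f" "u \<in> g" for f g u
  proof -
    have "u \<in> V" using M that by (auto simp: perfect_matching_def)
    with M have "\<exists>!f. f \<in> M \<and> u \<in> f" by (auto simp: perfect_matching_def)
    with that show ?thesis by blast
  qed
  show "M - {e} \<subseteq> {f \<in> E. f \<subseteq> V - e}"
    using M uniq[OF e] by (auto simp: perfect_matching_def)
  fix u assume u: "u \<in> V - e"
  then have "\<exists>!f. f \<in> M \<and> u \<in> f" using M by (auto simp: perfect_matching_def)
  with u show "\<exists>!f. f \<in> M - {e} \<and> u \<in> f" by blast
qed

text \<open>A matching contains exactly one edge at \<open>v\<close>; removing it leaves a matching of the graph without
the endpoints of that edge, and every such matching arises.\<close>
lemma matching_sum_on_expand: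
  assumes fin: "finite E" and v: "v \<in> V"
  shows "matching_sum_on w E V =
    (\<Sum>e | e \<in> E \<and> e \<subseteq> V \<and> v \<in> e. w e * matching_sum_on w E (V - e))"
proof -
  define A where "A = {e. e \<in> E \<and> e \<subseteq> V \<and> v \<in> e}"
  define PM where "PM = (\<lambda>U. {M. perfect_matching U {e \<in> E. e \<subseteq> U} M})"
  have PM_E: "M \<subseteq> E" if "M \<in> PM U" for M U
    using that by (auto simp: PM_def perfect_matching_def)
  have finPM: "finite (PM U)" for U
    by (rule finite_subset[of _ "Pow E"]) (use fin PM_E in auto)
  have finA: "finite A" using fin by (simp add: A_def)
  have notin: "e \<notin> M" if "e \<in> A" "M \<in> PM (V - e)" for e M
    using that by (auto simp: A_def PM_def perfect_matching_def)
  have ins: "insert e M \<in> PM V" if "e \<in> A" "M \<in> PM (V - e)" for e M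
    using that matching_insert[of e E V M] by (auto simp: A_def PM_def)
  have part: "PM V = (\<Union>e\<in>A. insert e ` PM (V - e))"
  proof
    show "PM V \<subseteq> (\<Union>e\<in>A. insert e ` PM (V - e))"
    proof
      fix M assume M: "M \<in> PM V"
      then obtain e where e: "e \<in> M" "v \<in> e"
        using v by (auto simp: PM_def perfect_matching_def)
      have "e \<in> A" using M e by (auto simp: PM_def perfect_matching_def A_def)
      moreover have "M - {e} \<in> PM (V - e)"
        using M e matching_remove[of V E M e] by (simp add: PM_def)
      moreover have "M = insert e (M - {e})" using e by auto
      ultimately show "M \<in> (\<Union>e\<in>A. insert e ` PM (V - e))" by blast
    qed
  qed (use ins in auto)
  have disj: "insert e ` PM (V - e) \<inter> insert f ` PM (V - f) = {}"
    if "e \<in> A" "f \<in> A" "e \<noteq> f" for e f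
  proof (rule ccontr)
    assume "\<not> ?thesis"
    then obtain M where M: "M \<in> insert e ` PM (V - e)" "M \<in> insert f ` PM (V - f)" by blast
    then have "M \<in> PM V" "e \<in> M" "f \<in> M" using ins that by auto
    moreover have "v \<in> e" "v \<in> f" using that by (auto simp: A_def)
    ultimately show False using v that(3) unfolding PM_def perfect_matching_def by blast
  qed
  have "matching_sum_on w E V = sum (prod w) (PM V)"
    by (simp add: matching_sum_on_def PM_def)
  also have "\<dots> = (\<Sum>e\<in>A. sum (prod w) (insert e ` PM (V - e)))"
    unfolding part by (rule sum.UNION_disjoint) (use finA finPM disj in auto)
  also have "\<dots> = (\<Sum>e\<in>A. w e * matching_sum_on w E (V - e))"
  proof (rule sum.cong)
    fix e assume e: "e \<in> A"
    have "inj_on (insert e) (PM (V - e))"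
      by (rule inj_onI) (metis notin[OF e] insert_ident)
    then have "sum (prod w) (insert e ` PM (V - e)) = (\<Sum>M\<in>PM (V - e). prod w (insert e M))"
      by (simp add: sum.reindex)
    also have "\<dots> = (\<Sum>M\<in>PM (V - e). w e * prod w M)"
      by (intro sum.cong refl prod.insert notin e) (use PM_E fin finite_subset in blast)+
    also have "\<dots> = w e * matching_sum_on w E (V - e)"
      by (simp add: sum_distrib_left matching_sum_on_def PM_def)
    finally show "sum (prod w) (insert e ` PM (V - e)) = w e * matching_sum_on w E (V - e)" .
  qed simp
  finally show ?thesis by (simp add: A_def)
qed

text \<open>The effect of gluing a box with new vertices \<open>u', v'\<close> along an edge with endpoints \<open>u, v\<close>, where
\<open>u'\<close> is a new neighbor of \<open>u\<close> and \<open>v'\<close> of \<open>v\<close>. Expanding at \<open>v'\<close> gives the first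
equation. For the second one, \<open>u'\<close> has lost its neighbor \<open>v'\<close>, so it must be matched with \<open>u\<close>.\<close>
lemma matching_sum_on_glue:
  assumes fin: "finite E"
    and old: "u \<in> V" "v \<in> V" "u \<noteq> v" and new: "u' \<notin> V" "v' \<notin> V" "u' \<noteq> v'"
    and V': "V' = insert u' (insert v' V)"
    and at_u': "{e. e \<in> E \<and> e \<subseteq> V' \<and> u' \<in> e} = {{u, u'}, {u', v'}}"
    and at_v': "{e. e \<in> E \<and> e \<subseteq> V' \<and> v' \<in> e} = {{v, v'}, {u', v'}}"
  shows "matching_sum_on w E V' =
      w {u', v'} * matching_sum_on w E V + w {v, v'} * matching_sum_on w E (V' - {v, v'})"
    and "matching_sum_on w E (V' - {v, v'}) = w {u, u'} * matching_sum_on w E (V - {u, v})"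
proof -
  have v': "v' \<in> V'" using V' by simp
  have "V' - {u', v'} = V" using new V' by auto
  moreover have "{v, v'} \<noteq> {u', v'}" using old new by (auto simp: doubleton_eq_iff)
  ultimately show "matching_sum_on w E V' =
      w {u', v'} * matching_sum_on w E V + w {v, v'} * matching_sum_on w E (V' - {v, v'})"
    using matching_sum_on_expand[OF fin, of v' V' w] v'
    by (simp add: at_v' add.commute)
next
  have "{e. e \<in> E \<and> e \<subseteq> V' - {v, v'} \<and> u' \<in> e} =
      {e \<in> {{u, u'}, {u', v'}}. e \<subseteq> V' - {v, v'}}"
    unfolding at_u'[symmetric] by blast
  also have "\<dots> = {{u, u'}}" using old new V' by auto
  finally have at: "{e. e \<in> E \<and> e \<subseteq> V' - {v, v'} \<and> u' \<in> e} = {{u, u'}}" .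
  have u': "u' \<in> V' - {v, v'}" using old new V' by auto
  have "V' - {v, v'} - {u, u'} = V - {u, v}" using old new V' by auto
  then show "matching_sum_on w E (V' - {v, v'}) = w {u, u'} * matching_sum_on w E (V - {u, v})"
    using matching_sum_on_expand[OF fin u', of w] by (simp add: at)
qed

section \<open>Snake graphs as step sequences\<close>

text \<open>In the box number \<open>t\<close>, counted from 0, the south and the east edge carry this sign and the north
and the west edge the opposite one: consecutive boxes share an edge that is east or north in the
first and west or south in the second box, so the signs flip from each box to the next.\<close>
definition south_sign :: "nat \<Rightarrow> edge_sign" where
  "south_sign t = (if even t then Minus else Plus)"

text \<open>The sign of the edge shared with the next box decides where that box is attached: the east edge of
box \<open>t\<close> has sign \<open>south_sign t\<close> and its north edge has the other sign. As the entry
\<open>ss ! 0\<close> is the sign of the south edge of the first box, the edge between the boxes \<open>t\<close> and \<open>t + 1\<close>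
has the sign \<open>ss ! Suc t\<close>.\<close>
fun box_at :: "edge_sign list \<Rightarrow> nat \<Rightarrow> box" where
  "box_at ss 0 = (0, 0)"
| "box_at ss (Suc t) =
     (let (x, y) = box_at ss t in if ss ! Suc t = south_sign t then (x + 1, y) else (x, y + 1))"

definition snake_boxes :: "edge_sign list \<Rightarrow> box list" where
  "snake_boxes ss = map (box_at ss) [0..<length ss]"

lemma box_at_sum: "fst (box_at ss t) + snd (box_at ss t) = int t"
  by (induction t) (auto simp: Let_def split: prod.splits)

lemma box_at_sum': "box_at ss t = (x, y) \<Longrightarrow> x + y = int t"
  using box_at_sum[of ss t] by simp

lemma box_at_fst_nonneg: "fst (box_at ss t) \<ge> 0"
  by (induction t) (auto simp: Let_def split: prod.splits)

lemma set_snake_boxes: "set (snake_boxes ss) = box_at ss ` {..<length ss}"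
  by (auto simp: snake_boxes_def)

lemma box_at_in_snake_boxes: "t < length ss \<Longrightarrow> box_at ss t \<in> set (snake_boxes ss)"
  by (simp add: set_snake_boxes)

text \<open>A snake meets each antidiagonal in a single box. This is how the absence of a neighboring box, and
hence the border status of an edge, is established.\<close>
lemma snake_box_eq_box_at:
  assumes "(x, y) \<in> set (snake_boxes ss)" "x + y = int t"
  shows "box_at ss t = (x, y)"
proof -
  obtain s where "box_at ss s = (x, y)" using assms(1) by (auto simp: set_snake_boxes)
  with box_at_sum'[OF this] assms(2) show ?thesis by simp
qed

section \<open>Weights of the border edges\<close>

lemma north_eq_south: "north (x, y) = south (x, y + 1)"
  by simp

lemma east_eq_west: "east (x, y) = west (x + 1, y)"
  by simp

lemma south_eq_south: "south b = south c \<longleftrightarrow> b = c"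
  by (cases b; cases c) (simp only: south.simps doubleton_eq_iff prod.inject; presburger)

lemma west_eq_west: "west b = west c \<longleftrightarrow> b = c"
  by (cases b; cases c) (simp only: west.simps doubleton_eq_iff prod.inject; presburger)

lemma south_neq_west: "south b \<noteq> west c"
  by (cases b; cases c) (simp only: south.simps west.simps doubleton_eq_iff prod.inject; presburger)

text \<open>Reducing north and east edges to south and west ones avoids comparing two-element sets of grid
points.\<close>
lemmas unit_edge_simps = north_eq_south east_eq_west south_eq_south west_eq_west
  south_neq_west south_neq_west[symmetric]

lemma box_edges_eq: "box_edges (x, y) = {south (x, y), south (x, y + 1), west (x, y), west (x + 1, y)}"
  by (simp only: box_edges_def north_eq_south east_eq_west)

lemma south_in_box_edges: "south (x, y) \<in> box_edges b \<longleftrightarrow> b = (x, y) \<or> b = (x, y - 1)"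
  by (cases b) (auto simp: box_edges_eq unit_edge_simps simp del: south.simps west.simps)

lemma west_in_box_edges: "west (x, y) \<in> box_edges b \<longleftrightarrow> b = (x, y) \<or> b = (x - 1, y)"
  by (cases b) (auto simp: box_edges_eq unit_edge_simps simp del: south.simps west.simps)

text \<open>North and east edges are never colored: seen as the south or west edge of some other box, they
would have to belong to that box only.\<close>
lemma edge_weight_north:
  assumes "b \<in> set bs"
  shows "edge_weight bs (north b) = 1"
proof -
  obtain x y where b: "b = (x, y)" by (cases b)
  have "b \<in> boxes_at bs (north b)" using assms by (simp add: boxes_at_def box_edges_def)
  moreover have "b \<noteq> (x, y + 1)" using b by simp
  ultimately have "boxes_at bs (north b) \<noteq> {(x, y + 1)}" by auto
  then have "\<not> southern_border bs (north b) c" "\<not> western_border bs (north b) c" for c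
    unfolding southern_border_def western_border_def b
    by (auto simp: unit_edge_simps simp del: south.simps west.simps north.simps)
  then show ?thesis by (simp add: edge_weight_def blue_def red_def)
qed

lemma edge_weight_east:
  assumes "b \<in> set bs"
  shows "edge_weight bs (east b) = 1"
proof -
  obtain x y where b: "b = (x, y)" by (cases b)
  have "b \<in> boxes_at bs (east b)" using assms by (simp add: boxes_at_def box_edges_def)
  moreover have "b \<noteq> (x + 1, y)" using b by simp
  ultimately have "boxes_at bs (east b) \<noteq> {(x + 1, y)}" by auto
  then have "\<not> southern_border bs (east b) c" "\<not> western_border bs (east b) c" for c
    unfolding southern_border_def western_border_def b
    by (auto simp: unit_edge_simps simp del: south.simps west.simps east.simps)
  then show ?thesis by (simp add: edge_weight_def blue_def red_def)
qed

lemma edge_weight_south: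
  assumes "(x, y) \<in> set bs" "(x, y - 1) \<notin> set bs"
  shows "edge_weight bs (south (x, y)) =
    (if x < 1 then 1 else if odd (x + y) then qvar else inverse qvar)"
proof -
  have "boxes_at bs (south (x, y)) = {(x, y)}"
    using assms by (auto simp: boxes_at_def south_in_box_edges simp del: south.simps)
  then have "southern_border bs (south (x, y)) c \<longleftrightarrow> c = (x, y)"
      "\<not> western_border bs (south (x, y)) c" for c
    by (auto simp: southern_border_def western_border_def unit_edge_simps
        simp del: south.simps west.simps)
  then show ?thesis by (auto simp: edge_weight_def blue_def red_def simp del: south.simps)
qed

lemma edge_weight_west:
  assumes "(x, y) \<in> set bs" "(x - 1, y) \<notin> set bs"
  shows "edge_weight bs (west (x, y)) = (if even (x + y) then qvar else inverse qvar)"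
proof -
  have "boxes_at bs (west (x, y)) = {(x, y)}"
    using assms by (auto simp: boxes_at_def west_in_box_edges simp del: west.simps)
  then have "western_border bs (west (x, y)) c \<longleftrightarrow> c = (x, y)"
      "\<not> southern_border bs (west (x, y)) c" for c
    by (auto simp: southern_border_def western_border_def unit_edge_simps
        simp del: south.simps west.simps)
  then show ?thesis by (auto simp: edge_weight_def blue_def red_def simp del: west.simps)
qed

text \<open>The weight that gluing along an edge of the given sign contributes, as
\<open>edge_weight_south_step\<close> and \<open>edge_weight_west_step\<close> show.\<close>
definition sign_weight :: "edge_sign \<Rightarrow> int poly fract" where
  "sign_weight s = (case s of Minus \<Rightarrow> qvar | Plus \<Rightarrow> inverse qvar)"

text \<open>If box \<open>t + 1\<close> is attached at the right, its south edge is on the border because the box below it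
would lie on the antidiagonal of box \<open>t\<close>. Blue means \<open>t\<close> even, which is also when the shared
east edge of box \<open>t\<close> has sign \<open>Minus\<close>.\<close>
lemma edge_weight_south_step:
  assumes t: "Suc t < length ss" and right: "ss ! Suc t = south_sign t"
  shows "edge_weight (snake_boxes ss) (south (box_at ss (Suc t))) = sign_weight (ss ! Suc t)"
proof -
  obtain x y where b: "box_at ss t = (x, y)" by (cases "box_at ss t")
  then have c: "box_at ss (Suc t) = (x + 1, y)" using right by simp
  have sum: "x + y = int t" by (rule box_at_sum'[OF b])
  have "(x + 1, y) \<in> set (snake_boxes ss)"
    using box_at_in_snake_boxes[OF t] c by simp
  moreover have "(x + 1, y - 1) \<notin> set (snake_boxes ss)"
    using snake_box_eq_box_at[of "x + 1" "y - 1" ss t] b sum by auto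
  moreover have "x \<ge> 0" using box_at_fst_nonneg[of ss t] b by simp
  moreover have "odd (x + 1 + y) \<longleftrightarrow> even t" using sum by presburger
  ultimately show ?thesis
    using right unfolding c
    by (subst edge_weight_south) (auto simp: sign_weight_def south_sign_def)
qed

text \<open>The mirror image: the western border is colored with the opposite parity, and the north edge shared
in this case has the opposite sign, so the weight is the same function of the sign.\<close>
lemma edge_weight_west_step:
  assumes t: "Suc t < length ss" and top: "ss ! Suc t \<noteq> south_sign t"
  shows "edge_weight (snake_boxes ss) (west (box_at ss (Suc t))) = sign_weight (ss ! Suc t)"
proof -
  obtain x y where b: "box_at ss t = (x, y)" by (cases "box_at ss t")
  then have c: "box_at ss (Suc t) = (x, y + 1)" using top by simp
  have sum: "x + y = int t" by (rule box_at_sum'[OF b])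
  have "(x, y + 1) \<in> set (snake_boxes ss)"
    using box_at_in_snake_boxes[OF t] c by simp
  moreover have "(x - 1, y + 1) \<notin> set (snake_boxes ss)"
    using snake_box_eq_box_at[of "x - 1" "y + 1" ss t] b sum by auto
  moreover have "odd (x + (y + 1)) \<longleftrightarrow> even t" using sum by presburger
  ultimately show ?thesis
    using top unfolding c
    by (subst edge_weight_west)
      (cases "ss ! Suc t"; auto simp: sign_weight_def south_sign_def split: if_splits)+
qed

lemma edge_weight_first_box:
  assumes "ss \<noteq> []"
  shows "edge_weight (snake_boxes ss) (south (0, 0)) = 1"
    and "edge_weight (snake_boxes ss) (west (0, 0)) = qvar"
proof -
  have b: "(0, 0) \<in> set (snake_boxes ss)"
    using box_at_in_snake_boxes[of 0 ss] assms by simp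
  have "(x, y) \<notin> set (snake_boxes ss)" if "x + y = -1" for x y
  proof
    assume "(x, y) \<in> set (snake_boxes ss)"
    then obtain s where "box_at ss s = (x, y)" by (auto simp: set_snake_boxes)
    with box_at_sum'[OF this] that show False by simp
  qed
  then show "edge_weight (snake_boxes ss) (south (0, 0)) = 1"
    and "edge_weight (snake_boxes ss) (west (0, 0)) = qvar"
    using b by (simp_all add: edge_weight_south edge_weight_west del: south.simps west.simps)
qed

section \<open>Growing the snake box by box\<close>

fun corners :: "box \<Rightarrow> vertex set" where
  "corners (x, y) = {(x, y), (x + 1, y), (x, y + 1), (x + 1, y + 1)}"

definition vertices_upto :: "edge_sign list \<Rightarrow> nat \<Rightarrow> vertex set" where
  "vertices_upto ss t = (\<Union>s\<le>t. corners (box_at ss s))"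

lemma snake_vertices_snake_boxes:
  assumes "length ss = Suc t"
  shows "snake_vertices (snake_boxes ss) = vertices_upto ss t"
proof -
  have "\<Union>(box_edges b) = corners b" for b
    by (cases b) (auto simp: box_edges_def)
  moreover have "snake_vertices bs = (\<Union>b\<in>set bs. \<Union>(box_edges b))" for bs
    by (auto simp: snake_vertices_def snake_edges_def)
  ultimately have "snake_vertices (snake_boxes ss) = (\<Union>b\<in>set (snake_boxes ss). corners b)"
    by simp
  also have "\<dots> = vertices_upto ss t"
    using assms by (simp add: set_snake_boxes vertices_upto_def lessThan_Suc_atMost)
  finally show ?thesis .
qed

lemma vertices_upto_0: "vertices_upto ss 0 = corners (0, 0)"
  by (simp add: vertices_upto_def)

lemma vertices_upto_Suc: "vertices_upto ss (Suc t) = corners (box_at ss (Suc t)) \<union> vertices_upto ss t"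
  by (simp add: vertices_upto_def atMost_Suc)

lemma corners_subset: "corners (box_at ss t) \<subseteq> vertices_upto ss t"
  by (auto simp: vertices_upto_def)

text \<open>Snakes only move right and up, so no earlier vertex lies beyond the north-east corner of the
current box. This is what isolates the two new vertices of the next box.\<close>
lemma vertices_upto_bound:
  assumes "p \<in> vertices_upto ss t" "box_at ss t = (x, y)"
  shows "fst p \<le> x + 1" "snd p \<le> y + 1"
proof -
  have "fst p \<le> fst (box_at ss t) + 1 \<and> snd p \<le> snd (box_at ss t) + 1"
    using assms(1)
  proof (induction t)
    case 0
    then show ?case by (auto simp: vertices_upto_0)
  next
    case (Suc t)
    then show ?case
      by (cases "box_at ss t") (auto simp: vertices_upto_Suc split: if_splits)
  qed
  then show "fst p \<le> x + 1" "snd p \<le> y + 1" using assms(2) by simp_all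
qed

lemma vertices_upto_right:
  assumes "box_at ss t = (x, y)" "ss ! Suc t = south_sign t"
  shows "vertices_upto ss (Suc t) = insert (x + 2, y) (insert (x + 2, y + 1) (vertices_upto ss t))"
  using assms corners_subset[of ss t] by (auto simp: vertices_upto_Suc)

lemma vertices_upto_top:
  assumes "box_at ss t = (x, y)" "ss ! Suc t \<noteq> south_sign t"
  shows "vertices_upto ss (Suc t) = insert (x, y + 2) (insert (x + 1, y + 2) (vertices_upto ss t))"
  using assms corners_subset[of ss t] by (auto simp: vertices_upto_Suc)

lemma snake_edge_unit:
  assumes "e \<in> snake_edges bs"
  obtains x y where "e = {(x, y), (x + 1, y)}" | x y where "e = {(x, y), (x, y + 1)}"
  using assms by (auto simp: snake_edges_def box_edges_def)

lemma finite_snake_edges: "finite (snake_edges bs)"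
  by (auto simp: snake_edges_def box_edges_def)

lemma empty_notin_snake_edges: "{} \<notin> snake_edges bs"
  by (auto simp: snake_edges_def box_edges_def)

lemma box_edges_in_snake_edges:
  assumes "t < length ss" "e \<in> box_edges (box_at ss t)"
  shows "e \<in> snake_edges (snake_boxes ss)"
  using assms by (auto simp: snake_edges_def set_snake_boxes)

lemma snake_edges_at_corner:
  assumes "e \<in> snake_edges bs" "(x, y) \<in> e"
  shows "e = {(x - 1, y), (x, y)} \<or> e = {(x, y), (x + 1, y)} \<or>
    e = {(x, y - 1), (x, y)} \<or> e = {(x, y), (x, y + 1)}"
  using assms(1)
proof (cases rule: snake_edge_unit)
  case (1 x' y')
  with assms(2) consider "x' = x" "y' = y" | "x' = x - 1" "y' = y" by auto
  then show ?thesis by cases (simp_all add: 1)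
next
  case (2 x' y')
  with assms(2) consider "x' = x" "y' = y" | "x' = x" "y' = y - 1" by auto
  then show ?thesis by cases (simp_all add: 2)
qed

lemma snake_edges_at:
  assumes mem: "e1 \<in> snake_edges bs" "e2 \<in> snake_edges bs" "e1 \<subseteq> V" "e2 \<subseteq> V"
      "(x, y) \<in> e1" "(x, y) \<in> e2"
    and only: "\<And>e. e \<subseteq> V \<Longrightarrow> e = {(x - 1, y), (x, y)} \<or> e = {(x, y), (x + 1, y)} \<or>
      e = {(x, y - 1), (x, y)} \<or> e = {(x, y), (x, y + 1)} \<Longrightarrow> e = e1 \<or> e = e2"
  shows "{e. e \<in> snake_edges bs \<and> e \<subseteq> V \<and> (x, y) \<in> e} = {e1, e2}"
proof
  show "{e. e \<in> snake_edges bs \<and> e \<subseteq> V \<and> (x, y) \<in> e} \<subseteq> {e1, e2}"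
  proof
    fix e assume "e \<in> {e. e \<in> snake_edges bs \<and> e \<subseteq> V \<and> (x, y) \<in> e}"
    then have e: "e \<in> snake_edges bs" "(x, y) \<in> e" and "e \<subseteq> V" by simp_all
    from only[OF this(3) snake_edges_at_corner[OF e]] show "e \<in> {e1, e2}" by simp
  qed
  show "{e1, e2} \<subseteq> {e. e \<in> snake_edges bs \<and> e \<subseteq> V \<and> (x, y) \<in> e}"
    using mem by simp
qed

section \<open>The transfer recursion\<close>

context
  fixes ss :: "edge_sign list"
begin

abbreviation induced_sum :: "vertex set \<Rightarrow> int poly fract" where
  "induced_sum \<equiv> matching_sum_on (edge_weight (snake_boxes ss)) (snake_edges (snake_boxes ss))"

text \<open>Instances of \<open>matching_sum_on_glue\<close>: the old edge is the east edge of \<open>b\<close>, the new vertices are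
the two eastern corners of \<open>b'\<close>. Deleting the east edge of \<open>b'\<close> returns the smaller snake, and
after deleting its north edge the south-east corner can only use the new southern border edge.\<close>
lemma attach_right:
  assumes t: "Suc t < length ss" and right: "ss ! Suc t = south_sign t"
  defines "b \<equiv> box_at ss t" and "b' \<equiv> box_at ss (Suc t)"
    and "V \<equiv> vertices_upto ss t" and "V' \<equiv> vertices_upto ss (Suc t)"
  shows "induced_sum V' = induced_sum V + induced_sum (V' - north b')"
    and "induced_sum (V' - east b') = induced_sum V"
    and "induced_sum (V' - north b') = sign_weight (ss ! Suc t) * induced_sum (V - east b)"
proof -
  obtain x y where b: "box_at ss t = (x, y)" by (cases "box_at ss t")
  then have b': "b' = (x + 1, y)" using right by (simp add: b'_def)
  have V': "V' = insert (x + 2, y) (insert (x + 2, y + 1) V)"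
    unfolding V'_def V_def by (rule vertices_upto_right[OF b right])
  have old: "(x + 1, y) \<in> V" "(x + 1, y + 1) \<in> V"
    using corners_subset[of ss t] b by (auto simp: V_def)
  have bound: "p \<le> x + 1" "r \<le> y + 1" if "(p, r) \<in> V" for p r
    using vertices_upto_bound[of "(p, r)" ss t x y] that b by (auto simp: V_def)
  have new: "(x + 2, y) \<notin> V" "(x + 2, y + 1) \<notin> V" using bound(1) by fastforce+
  have mem: "e \<in> snake_edges (snake_boxes ss)" if "e \<in> box_edges b'" for e
    using box_edges_in_snake_edges[OF t, of e] that by (simp add: b'_def)
  have edges: "south b' = {(x + 1, y), (x + 2, y)}" "north b' = {(x + 1, y + 1), (x + 2, y + 1)}"
    "east b' = {(x + 2, y), (x + 2, y + 1)}" "east b = {(x + 1, y), (x + 1, y + 1)}"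
    using b by (simp_all add: b' b_def add.commute)
  have "{e. e \<in> snake_edges (snake_boxes ss) \<and> e \<subseteq> V' \<and> (x + 2, y) \<in> e} = {south b', east b'}"
  proof (rule snake_edges_at)
    show "south b' \<in> snake_edges (snake_boxes ss)" "east b' \<in> snake_edges (snake_boxes ss)"
      by (auto intro!: mem simp: box_edges_def)
    fix e assume e: "e \<subseteq> V'" and cases: "e = {(x + 2 - 1, y), (x + 2, y)} \<or> e = {(x + 2, y), (x + 2 + 1, y)} \<or>
      e = {(x + 2, y - 1), (x + 2, y)} \<or> e = {(x + 2, y), (x + 2, y + 1)}"
    have "(x + 2 + 1, y) \<notin> V'" "(x + 2, y - 1) \<notin> V'"
      unfolding V' using bound(1) by fastforce+
    with e cases show "e = south b' \<or> e = east b'" by (auto simp: edges)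
  qed (use old in \<open>auto simp: edges V'\<close>)
  moreover have "{e. e \<in> snake_edges (snake_boxes ss) \<and> e \<subseteq> V' \<and> (x + 2, y + 1) \<in> e} = {north b', east b'}"
  proof (rule snake_edges_at)
    show "north b' \<in> snake_edges (snake_boxes ss)" "east b' \<in> snake_edges (snake_boxes ss)"
      by (auto intro!: mem simp: box_edges_def)
    fix e assume e: "e \<subseteq> V'" and cases: "e = {(x + 2 - 1, y + 1), (x + 2, y + 1)} \<or> e = {(x + 2, y + 1), (x + 2 + 1, y + 1)} \<or>
      e = {(x + 2, y + 1 - 1), (x + 2, y + 1)} \<or> e = {(x + 2, y + 1), (x + 2, y + 1 + 1)}"
    have "(x + 2 + 1, y + 1) \<notin> V'" "(x + 2, y + 1 + 1) \<notin> V'"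
      unfolding V' using bound(1) by fastforce+
    with e cases show "e = north b' \<or> e = east b'" by (auto simp: edges)
  qed (use old in \<open>auto simp: edges V'\<close>)
  moreover have "edge_weight (snake_boxes ss) (north b') = 1" "edge_weight (snake_boxes ss) (east b') = 1"
    unfolding b'_def using box_at_in_snake_boxes[OF t] by (rule edge_weight_north edge_weight_east)+
  moreover have "edge_weight (snake_boxes ss) (south b') = sign_weight (ss ! Suc t)"
    unfolding b'_def by (rule edge_weight_south_step[OF t right])
  ultimately show "induced_sum V' = induced_sum V + induced_sum (V' - north b')"
    and "induced_sum (V' - north b') = sign_weight (ss ! Suc t) * induced_sum (V - east b)"
    using matching_sum_on_glue[OF finite_snake_edges old _ new _ V',
        of "snake_boxes ss" "edge_weight (snake_boxes ss)"]
    by (simp_all add: edges)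
  have "V' - east b' = V" using new by (auto simp: edges V')
  then show "induced_sum (V' - east b') = induced_sum V" by simp
qed

text \<open>The same with the roles of the two coordinates exchanged: the new vertices are the two northern
corners of \<open>b'\<close>, and the weighted edge is its west edge.\<close>
lemma attach_top:
  assumes t: "Suc t < length ss" and top: "ss ! Suc t \<noteq> south_sign t"
  defines "b \<equiv> box_at ss t" and "b' \<equiv> box_at ss (Suc t)"
    and "V \<equiv> vertices_upto ss t" and "V' \<equiv> vertices_upto ss (Suc t)"
  shows "induced_sum V' = induced_sum V + induced_sum (V' - east b')"
    and "induced_sum (V' - north b') = induced_sum V"
    and "induced_sum (V' - east b') = sign_weight (ss ! Suc t) * induced_sum (V - north b)"
proof -
  obtain x y where b: "box_at ss t = (x, y)" by (cases "box_at ss t")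
  then have b': "b' = (x, y + 1)" using top by (simp add: b'_def)
  have V': "V' = insert (x, y + 2) (insert (x + 1, y + 2) V)"
    unfolding V'_def V_def by (rule vertices_upto_top[OF b top])
  have old: "(x, y + 1) \<in> V" "(x + 1, y + 1) \<in> V"
    using corners_subset[of ss t] b by (auto simp: V_def)
  have bound: "p \<le> x + 1" "r \<le> y + 1" if "(p, r) \<in> V" for p r
    using vertices_upto_bound[of "(p, r)" ss t x y] that b by (auto simp: V_def)
  have new: "(x, y + 2) \<notin> V" "(x + 1, y + 2) \<notin> V" using bound(2) by fastforce+
  have mem: "e \<in> snake_edges (snake_boxes ss)" if "e \<in> box_edges b'" for e
    using box_edges_in_snake_edges[OF t, of e] that by (simp add: b'_def)
  have edges: "west b' = {(x, y + 1), (x, y + 2)}" "east b' = {(x + 1, y + 1), (x + 1, y + 2)}"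
    "north b' = {(x, y + 2), (x + 1, y + 2)}" "north b = {(x, y + 1), (x + 1, y + 1)}"
    using b by (simp_all add: b' b_def add.commute)
  have "{e. e \<in> snake_edges (snake_boxes ss) \<and> e \<subseteq> V' \<and> (x, y + 2) \<in> e} = {west b', north b'}"
  proof (rule snake_edges_at)
    show "west b' \<in> snake_edges (snake_boxes ss)" "north b' \<in> snake_edges (snake_boxes ss)"
      by (auto intro!: mem simp: box_edges_def)
    fix e assume e: "e \<subseteq> V'" and cases: "e = {(x - 1, y + 2), (x, y + 2)} \<or> e = {(x, y + 2), (x + 1, y + 2)} \<or>
      e = {(x, y + 2 - 1), (x, y + 2)} \<or> e = {(x, y + 2), (x, y + 2 + 1)}"
    have "(x - 1, y + 2) \<notin> V'" "(x, y + 2 + 1) \<notin> V'"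
      unfolding V' using bound(2) by fastforce+
    with e cases show "e = west b' \<or> e = north b'" by (auto simp: edges)
  qed (use old in \<open>auto simp: edges V'\<close>)
  moreover have "{e. e \<in> snake_edges (snake_boxes ss) \<and> e \<subseteq> V' \<and> (x + 1, y + 2) \<in> e} = {east b', north b'}"
  proof (rule snake_edges_at)
    show "east b' \<in> snake_edges (snake_boxes ss)" "north b' \<in> snake_edges (snake_boxes ss)"
      by (auto intro!: mem simp: box_edges_def)
    fix e assume e: "e \<subseteq> V'" and cases: "e = {(x + 1 - 1, y + 2), (x + 1, y + 2)} \<or> e = {(x + 1, y + 2), (x + 1 + 1, y + 2)} \<or>
      e = {(x + 1, y + 2 - 1), (x + 1, y + 2)} \<or> e = {(x + 1, y + 2), (x + 1, y + 2 + 1)}"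
    have "(x + 1 + 1, y + 2) \<notin> V'" "(x + 1, y + 2 + 1) \<notin> V'"
      unfolding V' using bound(2) by fastforce+
    with e cases show "e = east b' \<or> e = north b'" by (auto simp: edges)
  qed (use old in \<open>auto simp: edges V'\<close>)
  moreover have "edge_weight (snake_boxes ss) (north b') = 1" "edge_weight (snake_boxes ss) (east b') = 1"
    unfolding b'_def using box_at_in_snake_boxes[OF t] by (rule edge_weight_north edge_weight_east)+
  moreover have "edge_weight (snake_boxes ss) (west b') = sign_weight (ss ! Suc t)"
    unfolding b'_def by (rule edge_weight_west_step[OF t top])
  ultimately show "induced_sum V' = induced_sum V + induced_sum (V' - east b')"
    and "induced_sum (V' - east b') = sign_weight (ss ! Suc t) * induced_sum (V - north b)"
    using matching_sum_on_glue[OF finite_snake_edges old _ new _ V',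
        of "snake_boxes ss" "edge_weight (snake_boxes ss)"]
    by (simp_all add: edges)
  have "V' - north b' = V" using new by (auto simp: edges V')
  then show "induced_sum (V' - north b') = induced_sum V" by simp
qed

text \<open>The first box is obtained by gluing its two eastern corners to its west edge. As that edge has
weight \<open>q\<close> and the south edge weight 1, the result is what a step with sign \<open>Minus\<close> makes of the
vector \<open>(1, 0)\<close>.\<close>
lemma first_box:
  assumes ss: "ss \<noteq> []"
  defines "V \<equiv> vertices_upto ss 0"
  shows "induced_sum V = qvar + 1"
    and "induced_sum (V - east (0, 0)) = qvar"
    and "induced_sum (V - north (0, 0)) = 1"
proof -
  \<comment> \<open>the endpoints of the west edge, a graph with a single matching of weight \<open>q\<close>\<close>
  let ?W = "{(0, 0), (0, 1)} :: vertex set"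
  have V: "V = insert (1, 0) (insert (1, 1) ?W)"
    by (auto simp: V_def vertices_upto_0)
  have mem: "e \<in> snake_edges (snake_boxes ss)" if "e \<in> box_edges (0, 0)" for e
    using box_edges_in_snake_edges[of 0 ss e] that ss by simp
  have at: "{e. e \<in> snake_edges (snake_boxes ss) \<and> e \<subseteq> ?W \<and> (0, 0) \<in> e} = {west (0, 0)}"
  proof -
    have "{e. e \<in> snake_edges (snake_boxes ss) \<and> e \<subseteq> ?W \<and> (0, 0) \<in> e} = {west (0, 0), west (0, 0)}"
    proof (rule snake_edges_at)
      show "west (0, 0) \<in> snake_edges (snake_boxes ss)" by (rule mem) (simp add: box_edges_def)
      then show "west (0, 0) \<in> snake_edges (snake_boxes ss)" .
    qed (simp, simp, simp, simp, elim disjE, simp_all)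
    then show ?thesis by simp
  qed
  have "induced_sum ?W = (\<Sum>e\<in>{west (0, 0)}. edge_weight (snake_boxes ss) e * induced_sum (?W - e))"
    unfolding at[symmetric]
    by (rule matching_sum_on_expand[OF finite_snake_edges]) simp
  also have "\<dots> = edge_weight (snake_boxes ss) (west (0, 0)) * induced_sum {}"
    by simp
  finally have W: "induced_sum ?W = qvar"
    by (simp only: edge_weight_first_box(2)[OF ss] matching_sum_on_empty[OF empty_notin_snake_edges] mult_1_right)
  have "{e. e \<in> snake_edges (snake_boxes ss) \<and> e \<subseteq> V \<and> (1, 0) \<in> e} = {south (0, 0), east (0, 0)}"
  proof (rule snake_edges_at)
    show "south (0, 0) \<in> snake_edges (snake_boxes ss)" "east (0, 0) \<in> snake_edges (snake_boxes ss)"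
      by (rule mem, simp add: box_edges_def)+
  qed (simp add: V, simp add: V, simp, simp, elim disjE, simp_all add: V)
  moreover have "{e. e \<in> snake_edges (snake_boxes ss) \<and> e \<subseteq> V \<and> (1, 1) \<in> e} = {north (0, 0), east (0, 0)}"
  proof (rule snake_edges_at)
    show "north (0, 0) \<in> snake_edges (snake_boxes ss)" "east (0, 0) \<in> snake_edges (snake_boxes ss)"
      by (rule mem, simp add: box_edges_def)+
  qed (simp add: V, simp add: V, simp, simp, elim disjE, simp_all add: V)
  moreover have "edge_weight (snake_boxes ss) (north (0, 0)) = 1"
      "edge_weight (snake_boxes ss) (east (0, 0)) = 1"
    using edge_weight_north edge_weight_east box_at_in_snake_boxes[of 0 ss] ss by fastforce+
  ultimately show "induced_sum V = qvar + 1" and "induced_sum (V - north (0, 0)) = 1"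
    using matching_sum_on_glue[OF finite_snake_edges _ _ _ _ _ _ V,
        of "(0, 0)" "(0, 1)" "snake_boxes ss" "edge_weight (snake_boxes ss)"]
      edge_weight_first_box(1)[OF ss] W
    by (simp_all add: matching_sum_on_empty empty_notin_snake_edges)
  have "V - east (0, 0) = ?W" by (auto simp: V)
  with W show "induced_sum (V - east (0, 0)) = qvar" by simp
qed

end

text \<open>The pair consists of the matching sums that remain after deleting the north or east edge of the last
box, the component being selected by the sign of the deleted edge: first \<open>Minus\<close>, then \<open>Plus\<close>.\<close>
fun sign_step :: "edge_sign \<Rightarrow> int poly fract \<times> int poly fract \<Rightarrow> int poly fract \<times> int poly fract" where
  "sign_step Minus (u, v) = (qvar * u, u + v)"
| "sign_step Plus (u, v) = (u + v, inverse qvar * v)"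

text \<open>The parity distinction only sorts the two edges of box \<open>t\<close> by sign. After gluing along an edge
of sign \<open>s\<close>, the one among the north and east edges of the new box that meets the glued edge has
sign \<open>s\<close> again. By the gluing lemmas, its component is the old component of sign \<open>s\<close> multiplied by
the weight of \<open>s\<close>, and the other component is the matching sum of the previous snake.\<close>
lemma sign_step_matching_sums:
  assumes "t < length ss" and hd: "ss ! 0 = Minus"
  shows "fold sign_step (take (Suc t) ss) (1, 0) =
      (if even t
       then (induced_sum ss (vertices_upto ss t - east (box_at ss t)),
             induced_sum ss (vertices_upto ss t - north (box_at ss t)))
       else (induced_sum ss (vertices_upto ss t - north (box_at ss t)),
             induced_sum ss (vertices_upto ss t - east (box_at ss t))))
    \<and> induced_sum ss (vertices_upto ss t) =
      induced_sum ss (vertices_upto ss t - east (box_at ss t)) +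
      induced_sum ss (vertices_upto ss t - north (box_at ss t))"
  using assms(1)
proof (induction t)
  case 0
  then have "take (Suc 0) ss = [Minus]" using hd by (cases ss) auto
  then show ?case using 0 first_box[of ss] by (simp del: north.simps east.simps)
next
  case (Suc t)
  have take: "take (Suc (Suc t)) ss = take (Suc t) ss @ [ss ! Suc t]"
    using Suc.prems by (rule take_Suc_conv_app_nth)
  show ?case
  proof (cases "ss ! Suc t = south_sign t")
    case True
    from attach_right[OF Suc.prems True] Suc.IH Suc.prems True show ?thesis
      unfolding take
      by (auto simp: south_sign_def sign_weight_def add_ac simp del: box_at.simps split: if_splits)
  next
    case False
    then have sign: "ss ! Suc t = (if even t then Plus else Minus)"
      by (cases "ss ! Suc t") (auto simp: south_sign_def split: if_splits)
    from attach_top[OF Suc.prems False] Suc.IH Suc.prems sign show ?thesis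
      unfolding take
      by (auto simp: south_sign_def sign_weight_def add_ac simp del: box_at.simps split: if_splits)
  qed
qed

text \<open>The matching sum is the sum of the two components. One more step with sign \<open>Plus\<close> puts this sum
into the first component; this is the last sign of an expansion of even length, which has no box of
its own.\<close>
lemma matching_sum_snake_boxes:
  assumes "ss \<noteq> []" "ss ! 0 = Minus"
  shows "matching_sum (snake_boxes ss) = fst (fold sign_step (ss @ [Plus]) (1, 0))"
proof -
  obtain t where t: "length ss = Suc t" using assms(1) by (cases "length ss") auto
  then have "take (Suc t) ss = ss" by simp
  with sign_step_matching_sums[of t ss] t assms(2) show ?thesis
    by (auto simp: matching_sum_eq_matching_sum_on snake_vertices_snake_boxes[OF t] add_ac)
qed

section \<open>The two expansions of a rational number\<close>

text \<open>Normal form of an expansion: a final coefficient 1 is absorbed into its predecessor.\<close>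
fun collapse :: "nat list \<Rightarrow> nat list" where
  "collapse [] = []"
| "collapse [a] = [a]"
| "collapse (a # b # as) = (if as = [] \<and> b = 1 then [a + 1] else a # collapse (b # as))"

lemma collapse_Cons_neq_Nil: "collapse (a # as) \<noteq> []"
  by (cases as) auto

lemma collapse_Cons: obtains c cs where "collapse (a # as) = c # cs"
  using collapse_Cons_neq_Nil[of a as] by (cases "collapse (a # as)") auto

lemma collapse_pos: "\<forall>a\<in>set as. a \<ge> 1 \<Longrightarrow> \<forall>a\<in>set (collapse as). a \<ge> 1"
  by (induction as rule: collapse.induct) auto

lemma last_collapse:
  assumes "\<forall>a\<in>set as. a \<ge> 1" "as \<noteq> []"
  shows "length (collapse as) = 1 \<or> last (collapse as) \<ge> 2"
  using assms
proof (induction as rule: collapse.induct)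
  case (3 a b as)
  show ?case
  proof (cases "as = [] \<and> b = 1")
    case False
    have IH: "length (collapse (b # as)) = 1 \<or> 2 \<le> last (collapse (b # as))"
      using 3 False by simp
    have "2 \<le> last (collapse (b # as))"
    proof (cases as)
      case Nil
      with 3(2) False show ?thesis by auto
    next
      case (Cons c cs)
      with IH 3(2-) show ?thesis by (cases "cs = [] \<and> c = 1") (auto split: if_splits simp: collapse_Cons_neq_Nil)
    qed
    then show ?thesis using False by (simp add: collapse_Cons_neq_Nil del: collapse.simps(3)) (simp add: collapse_Cons_neq_Nil)
  qed simp
qed simp_all

lemma cf_value_collapse: "cf_value (collapse as) = cf_value as"
proof (induction as rule: collapse.induct)
  case (3 a b as)
  obtain c cs where "collapse (b # as) = c # cs" by (rule collapse_Cons)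
  with 3 show ?case by auto
qed simp_all

lemma q_cf_collapse: "q_cf p (collapse as) = q_cf p as"
proof (induction as arbitrary: p rule: collapse.induct)
  case (3 a b as)
  obtain c cs where "collapse (b # as) = c # cs" by (rule collapse_Cons)
  with 3 show ?case by (auto simp: q_int_def)
qed simp_all

lemma cf_value_gt_1:
  assumes "\<forall>a\<in>set as. a \<ge> 1" "as \<noteq> []" "last as \<ge> 2"
  shows "cf_value as > 1"
  using assms
proof (induction as rule: cf_value.induct)
  case (3 a b as)
  then have "cf_value (b # as) > 1" by simp
  then have "1 / cf_value (b # as) > 0" by simp
  moreover have "(of_nat a :: rat) \<ge> 1" using 3 by simp
  ultimately show ?case unfolding cf_value.simps by linarith
qed simp_all

lemma floor_of_nat_plus_inverse:
  assumes "(v :: rat) > 1"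
  shows "\<lfloor>of_nat a + 1 / v\<rfloor> = int a"
  using assms by (intro floor_unique) (simp_all add: field_simps)

text \<open>Normal expansions are determined by their value: the tail of a longer one has value greater than 1,
so the first coefficient is the integer part and the tail is recovered from the fractional part.\<close>
lemma cf_value_inj:
  assumes "\<forall>a\<in>set as. a \<ge> 1" "as \<noteq> []" "length as = 1 \<or> last as \<ge> 2"
    and "\<forall>b\<in>set bs. b \<ge> 1" "bs \<noteq> []" "length bs = 1 \<or> last bs \<ge> 2"
    and "cf_value as = cf_value bs"
  shows "as = bs"
  using assms
proof (induction as arbitrary: bs)
  case (Cons a as)
  obtain b bs' where bs: "bs = b # bs'" using Cons.prems(5) by (cases bs) auto
  have split: "cf_value (c # cs) = of_nat c + 1 / cf_value cs" "cf_value cs > 1"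
    if "cs \<noteq> []" "\<forall>a\<in>set (c # cs). a \<ge> 1" "length (c # cs) = 1 \<or> last (c # cs) \<ge> 2"
    for c and cs :: "nat list"
    using that by (cases cs; simp add: cf_value_gt_1)+
  have frac: "of_nat c + 1 / v \<noteq> (of_nat d :: rat)" if "v > 1" for c d and v :: rat
  proof
    assume eq: "of_nat c + 1 / v = (of_nat d :: rat)"
    have "int c = \<lfloor>of_nat d :: rat\<rfloor>"
      using floor_of_nat_plus_inverse[OF that, of c] eq by simp
    then have "c = d" by simp
    with eq that show False by simp
  qed
  show ?case
  proof (cases "as = []")
    case True
    have "bs' = []"
    proof (rule ccontr)
      assume ne: "bs' \<noteq> []"
      note sb = split[OF ne Cons.prems(4)[unfolded bs] Cons.prems(6)[unfolded bs]]
      have "of_nat a = of_nat b + 1 / cf_value bs'"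
        using Cons.prems(7) True by (simp add: bs sb(1))
      with frac[OF sb(2)] show False by metis
    qed
    with True Cons.prems(7) show ?thesis by (simp add: bs)
  next
    case False
    note sa = split[OF False Cons.prems(1,3)]
    have ne: "bs' \<noteq> []"
    proof
      assume "bs' = []"
      then have "of_nat a + 1 / cf_value as = of_nat b"
        using Cons.prems(7) by (simp add: bs sa(1))
      with frac[OF sa(2)] show False by metis
    qed
    note sb = split[OF ne Cons.prems(4)[unfolded bs] Cons.prems(6)[unfolded bs]]
    have eq: "of_nat a + 1 / cf_value as = of_nat b + 1 / cf_value bs'"
      using Cons.prems(7) by (simp add: bs sa(1) sb(1))
    then have "int a = int b"
      using floor_of_nat_plus_inverse[OF sa(2), of a] floor_of_nat_plus_inverse[OF sb(2), of b]
      by simp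
    moreover from this eq have "cf_value as = cf_value bs'" by simp
    then have "as = bs'"
      using Cons.IH[of bs'] Cons.prems False ne by (simp add: bs)
    ultimately show ?thesis by (simp add: bs)
  qed
qed simp

lemma collapse_unique:
  assumes "cf_expansion x as" "cf_expansion x bs"
  shows "collapse as = collapse bs"
proof -
  have as: "\<forall>a\<in>set as. a \<ge> 1" "as \<noteq> []" and bs: "\<forall>b\<in>set bs. b \<ge> 1" "bs \<noteq> []"
    and eq: "cf_value as = cf_value bs"
    using assms by (simp_all add: cf_expansion_def)
  have ne: "collapse as \<noteq> []" "collapse bs \<noteq> []"
    using as(2) bs(2) collapse_Cons_neq_Nil by (metis neq_Nil_conv)+
  show ?thesis
    by (rule cf_value_inj[OF collapse_pos[OF as(1)] ne(1) last_collapse[OF as]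
          collapse_pos[OF bs(1)] ne(2) last_collapse[OF bs]])
      (simp add: cf_value_collapse eq)
qed

lemma q_rational_eq:
  assumes "cf_expansion x as"
  shows "q_rational x = q_cf qvar as"
  unfolding q_rational_def
proof (rule the_equality)
  show "\<exists>bs. cf_expansion x bs \<and> q_cf qvar as = q_cf qvar bs" using assms by blast
  fix v assume "\<exists>bs. cf_expansion x bs \<and> v = q_cf qvar bs"
  then show "v = q_cf qvar as"
    using collapse_unique[OF assms] q_cf_collapse by metis
qed

section \<open>Sign blocks\<close>

fun opposite :: "edge_sign \<Rightarrow> edge_sign" where
  "opposite Minus = Plus"
| "opposite Plus = Minus"

lemma opposite_opposite [simp]: "opposite (opposite s) = s"
  by (cases s) simp_all

fun block_signs :: "edge_sign \<Rightarrow> nat list \<Rightarrow> edge_sign list" where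
  "block_signs s [] = []"
| "block_signs s (a # as) = replicate a s @ block_signs (opposite s) as"

lemma block_signs_conv_concat:
  "block_signs s as =
    concat (map (\<lambda>i. replicate (as ! i) (if even i then s else opposite s)) [0..<length as])"
proof (induction as arbitrary: s)
  case (Cons a as)
  have "[0..<length (a # as)] = 0 # map Suc [0..<length as]"
    by (simp add: map_Suc_upt upt_conv_Cons del: upt_Suc)
  then show ?case
    by (simp add: Cons.IH comp_def del: upt_Suc) (intro arg_cong[where f = concat] map_cong refl; simp)
qed simp

lemma cf_signs_eq_block_signs: "cf_signs as = block_signs Minus as"
  by (simp add: cf_signs_def block_signs_conv_concat cong: if_cong)

lemma block_signs_neq_Nil: "\<forall>a\<in>set as. a \<ge> 1 \<Longrightarrow> as \<noteq> [] \<Longrightarrow> block_signs s as \<noteq> []"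
  by (cases as) auto

text \<open>Replacing \<open>[\<dots>, a, 1]\<close> by \<open>[\<dots>, a + 1]\<close> flips the last sign, while the snake is built from the signs before it.\<close>
lemma butlast_block_signs_collapse:
  assumes "\<forall>a\<in>set as. a \<ge> 1"
  shows "butlast (block_signs s (collapse as)) = butlast (block_signs s as)"
  using assms
proof (induction as arbitrary: s rule: collapse.induct)
  case (3 a b as)
  show ?case
  proof (cases "as = [] \<and> b = 1")
    case True
    then show ?thesis by (simp add: butlast_append replicate_append_same[symmetric])
  next
    case False
    have "block_signs (opposite s) (collapse (b # as)) \<noteq> []" "block_signs (opposite s) (b # as) \<noteq> []"
      using 3(2) block_signs_neq_Nil[OF collapse_pos collapse_Cons_neq_Nil, of b as]
        block_signs_neq_Nil[of "b # as"] by simp_all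
    moreover have "butlast (block_signs (opposite s) (collapse (b # as))) =
        butlast (block_signs (opposite s) (b # as))"
      using 3 False by simp
    moreover have "collapse (a # b # as) = a # collapse (b # as)" using False by simp
    ultimately show ?thesis by (simp only: block_signs.simps(2)[of s a] butlast_append if_False)
  qed
qed simp_all

lemma butlast_cf_signs_unique:
  assumes "cf_expansion x as" "cf_expansion x bs"
  shows "butlast (cf_signs as) = butlast (cf_signs bs)"
  using butlast_block_signs_collapse[of as Minus] butlast_block_signs_collapse[of bs Minus]
    collapse_unique[OF assms] assms
  by (simp add: cf_expansion_def cf_signs_eq_block_signs)

section \<open>Polynomial continuants\<close>

definition X :: "int poly" where "X = [:0, 1:]"

definition X_int :: "nat \<Rightarrow> int poly" where "X_int a = (\<Sum>i<a. X ^ i)"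

lemma to_fract_power: "to_fract (p ^ n) = to_fract p ^ n"
  by (induction n) simp_all

lemma to_fract_X [simp]: "to_fract X = qvar"
  by (simp add: X_def qvar_def)

lemma to_fract_X_int [simp]: "to_fract (X_int a) = q_int qvar a"
  by (simp add: X_int_def q_int_def to_fract_power)

lemma qvar_neq_0 [simp]: "qvar \<noteq> 0"
  by (simp add: qvar_def)

lemma q_int_0 [simp]: "q_int p 0 = 0"
  by (simp add: q_int_def)

lemma q_int_Suc: "q_int p (Suc a) = q_int p a + p ^ a"
  by (simp add: q_int_def)

lemma q_int_Suc': "q_int p (Suc a) = 1 + p * q_int p a"
  by (simp add: q_int_def sum.lessThan_Suc_shift sum_distrib_left del: sum.lessThan_Suc)

text \<open>Both sides are \<open>q + q\<^sup>2 + \<dots> + q\<^sup>a\<close>.\<close>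
lemma q_int_inverse: "qvar ^ a * q_int (inverse qvar) a = qvar * q_int qvar a"
proof (induction a)
  case (Suc a)
  have "qvar ^ Suc a * q_int (inverse qvar) (Suc a) =
      qvar * (qvar ^ a * q_int (inverse qvar) a) + qvar * (qvar ^ a * inverse qvar ^ a)"
    by (simp add: q_int_Suc algebra_simps)
  also have "\<dots> = qvar * q_int qvar (Suc a)"
    by (simp add: Suc.IH q_int_Suc' power_inverse algebra_simps)
  finally show ?case .
qed simp

lemma q_int_inverse': "q_int (inverse qvar) a = qvar * q_int qvar a / qvar ^ a"
  by (simp add: q_int_inverse[symmetric])

text \<open>Numerator and denominator of the continued fraction of an even expansion, cleared of negative powers
of \<open>q\<close>. Two coefficients \<open>a, b\<close> are processed at once, which multiplies the pair by the matrices
of \<open>a\<close> and \<open>b\<close>; the second of these is scaled by \<open>q\<^sup>b\<close>. Starting from the empty expansion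
\<open>(1, 0)\<close>, all pairs would have a common factor \<open>q\<close>; it is removed by giving the last two
coefficients an equation of their own, and this is the \<open>- 1\<close> in the exponent \<open>n\<close>.\<close>
fun continuant_polys :: "nat list \<Rightarrow> int poly \<times> int poly" where
  "continuant_polys (a # b # as) =
     (if as = [] then (X_int a * X_int b + X ^ (a + b - 1), X_int b)
      else let (P, Q) = continuant_polys as; Q' = X * X_int b * P + Q
           in (X_int a * Q' + X ^ (a + b) * P, Q'))"
| "continuant_polys _ = (0, 0)"

lemma continuant_polys_induct [consumes 3, case_names pair step]:
  assumes "\<forall>a\<in>set as. a \<ge> 1" "as \<noteq> []" "even (length as)"
    and "\<And>a b. a \<ge> 1 \<Longrightarrow> b \<ge> 1 \<Longrightarrow> Prop [a, b] (X_int a * X_int b + X ^ (a + b - 1)) (X_int b)"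
    and "\<And>a b as P Q. a \<ge> 1 \<Longrightarrow> b \<ge> 1 \<Longrightarrow> \<forall>a\<in>set as. a \<ge> 1 \<Longrightarrow> as \<noteq> [] \<Longrightarrow> even (length as) \<Longrightarrow>
      continuant_polys as = (P, Q) \<Longrightarrow> Prop as P Q \<Longrightarrow>
      Prop (a # b # as) (X_int a * (X * X_int b * P + Q) + X ^ (a + b) * P) (X * X_int b * P + Q)"
  shows "case continuant_polys as of (P, Q) \<Rightarrow> Prop as P Q"
  using assms(1-3)
proof (induction as rule: continuant_polys.induct)
  case (1 a b as)
  show ?case
  proof (cases "as = []")
    case True
    with 1 assms(4) show ?thesis by simp
  next
    case False
    obtain P Q where PQ: "continuant_polys as = (P, Q)" by fastforce
    with 1 False have "Prop as P Q" by simp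
    with assms(5)[OF _ _ _ _ _ PQ] 1 False PQ show ?thesis by (simp add: Let_def)
  qed
qed simp_all

lemma poly_X_0 [simp]: "poly X 0 = 0"
  by (simp add: X_def)

lemma X_neq_0 [simp]: "X \<noteq> 0"
  by (simp add: X_def)

lemma degree_X_power [simp]: "degree (X ^ n) = n"
  by (simp add: X_def degree_power_eq)

lemma degree_X [simp]: "degree X = 1"
  by (simp add: X_def)

lemma lead_coeff_X_power: "lead_coeff (X ^ n) = 1"
  by (simp only: lead_coeff_power) (simp add: X_def)

lemma poly_X_int_0: "a \<ge> 1 \<Longrightarrow> poly (X_int a) 0 = 1"
  by (cases a) (simp_all add: X_int_def poly_sum sum.lessThan_Suc_shift del: sum.lessThan_Suc)

lemma degree_X_int: "degree (X_int a) \<le> a - 1"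
  unfolding X_int_def by (rule degree_sum_le) auto

lemma coprime_X:
  assumes "poly p 0 = 1"
  shows "coprime X p"
proof -
  obtain r where "p = pCons 1 r"
    using assms by (cases p) simp
  then have "p = 1 + X * r" by (simp add: X_def one_pCons)
  then show ?thesis by (auto intro: coprimeI simp: dvd_add_left_iff)
qed

lemma continuant_polys_poly_0:
  assumes "\<forall>a\<in>set as. a \<ge> 1" "as \<noteq> []" "even (length as)"
  shows "case continuant_polys as of (P, Q) \<Rightarrow> poly P 0 = 1 \<and> poly Q 0 = 1"
  using assms by (induction rule: continuant_polys_induct) (auto simp: poly_X_int_0 power_0_left)

text \<open>The summand with the power of \<open>q\<close> dominates: a \<open>q\<close>-integer has degree one less than its argument.\<close>
lemma continuant_polys_monic:
  assumes "\<forall>a\<in>set as. a \<ge> 1" "as \<noteq> []" "even (length as)"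
  shows "case continuant_polys as of (P, Q) \<Rightarrow> lead_coeff P = 1 \<and> degree Q \<le> degree P"
  using assms
proof (induction rule: continuant_polys_induct)
  case (pair a b)
  have "degree (X_int a * X_int b) \<le> degree (X_int a) + degree (X_int b)" by (rule degree_mult_le)
  also have "\<dots> < a + b - 1" using degree_X_int[of a] degree_X_int[of b] pair by linarith
  finally have less: "degree (X_int a * X_int b) < degree (X ^ (a + b - 1))" by simp
  then have "degree (X_int a * X_int b + X ^ (a + b - 1)) = a + b - 1"
    using degree_add_eq_right[OF less] by simp
  moreover have "lead_coeff (X_int a * X_int b + X ^ (a + b - 1)) = 1"
    using lead_coeff_add_le[OF less] lead_coeff_X_power by metis
  moreover have "degree (X_int b) \<le> a + b - 1" using degree_X_int[of b] by linarith
  ultimately show ?case by metis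
next
  case (step a b as P Q)
  have P: "P \<noteq> 0" using step by auto
  have "degree (X * X_int b * P) \<le> degree (X ^ 1) + degree (X_int b) + degree P"
    using degree_mult_le[of "X * X_int b" P] degree_mult_le[of X "X_int b"] by simp
  also have "\<dots> \<le> b + degree P" using degree_X_int[of b] step by simp
  finally have Q': "degree (X * X_int b * P + Q) \<le> b + degree P"
    using step by (intro degree_add_le) simp_all
  have deg: "degree (X ^ (a + b) * P) = a + b + degree P"
    using P by (simp add: degree_mult_eq)
  have "degree (X_int a * (X * X_int b * P + Q)) < a + b + degree P"
    using degree_mult_le[of "X_int a" "X * X_int b * P + Q"] Q' degree_X_int[of a] step by linarith
  then have less: "degree (X_int a * (X * X_int b * P + Q)) < degree (X ^ (a + b) * P)"
    by (simp only: deg)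
  have "lead_coeff (X ^ (a + b) * P) = 1"
    using step lead_coeff_X_power by (simp only: lead_coeff_mult mult_1_left)
  then have "lead_coeff (X_int a * (X * X_int b * P + Q) + X ^ (a + b) * P) = 1"
    using lead_coeff_add_le[OF less] by metis
  moreover have "degree (X * X_int b * P + Q) \<le>
      degree (X_int a * (X * X_int b * P + Q) + X ^ (a + b) * P)"
    using degree_add_eq_right[OF less] Q' deg by linarith
  ultimately show ?case ..
qed

text \<open>In terms of the new denominator \<open>Q'\<close>, the new numerator is congruent to \<open>q\<^sup>a\<^sup>+\<^sup>b P\<close> modulo \<open>Q'\<close>, and \<open>Q'\<close> is
congruent to \<open>Q\<close> modulo \<open>P\<close>. The power of \<open>q\<close> is coprime to \<open>Q'\<close>, which has constant term 1.\<close>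
lemma continuant_polys_coprime:
  assumes "\<forall>a\<in>set as. a \<ge> 1" "as \<noteq> []" "even (length as)"
  shows "case continuant_polys as of (P, Q) \<Rightarrow> coprime P Q"
  using assms
proof (induction rule: continuant_polys_induct)
  case (pair a b)
  have "coprime (X ^ (a + b - 1)) (X_int b)"
    using coprime_X[OF poly_X_int_0] pair by simp
  then show ?case by (metis add.commute coprime_iff_gcd_eq_1 gcd.commute gcd_add_mult mult.commute)
next
  case (step a b as P Q)
  let ?Q' = "X * X_int b * P + Q"
  have "poly ?Q' 0 = 1"
    using continuant_polys_poly_0[of as] step by simp
  then have X: "coprime (X ^ (a + b)) ?Q'" by (simp add: coprime_X)
  have "coprime P ?Q'" using step
    by (metis add.commute coprime_iff_gcd_eq_1 gcd_add_mult mult.commute)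
  with X have "coprime (X ^ (a + b) * P) ?Q'" by simp
  then show ?case
    by (metis add.commute coprime_iff_gcd_eq_1 gcd.commute gcd_add_mult mult.commute)
qed

text \<open>Two levels of the continued fraction act on the value \<open>P / Q\<close> of the remaining expansion as the
Moebius transformation whose matrix is the one used in \<open>continuant_polys\<close>.\<close>
lemma q_cf_eq_continuant_polys:
  assumes "\<forall>a\<in>set as. a \<ge> 1" "as \<noteq> []" "even (length as)"
  shows "case continuant_polys as of (P, Q) \<Rightarrow> q_cf qvar as = to_fract P / to_fract Q"
  using assms
proof (induction rule: continuant_polys_induct)
  case (pair a b)
  have "to_fract (X_int b) \<noteq> 0" using poly_X_int_0[of b] pair by (metis poly_0 to_fract_eq_0_iff zero_neq_one)
  then have ne: "q_int qvar b \<noteq> 0" by simp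
  obtain k where b: "b = Suc k" using pair by (cases b) auto
  have "q_cf qvar [a, b] = q_int qvar a + qvar ^ a / (qvar * q_int qvar b / qvar ^ b)"
    by (simp only: q_cf.simps q_int_inverse')
  also have "\<dots> = (q_int qvar a * q_int qvar b + qvar ^ (a + b - 1)) / q_int qvar b"
    using ne by (simp add: field_simps b power_add)
  finally show ?case by (simp add: to_fract_power)
next
  case (step a b as P Q)
  let ?P = "to_fract P" and ?Q = "to_fract Q"
  have "poly P 0 = 1" "poly Q 0 = 1" using continuant_polys_poly_0[of as] step by simp_all
  moreover from this have "poly (X * X_int b * P + Q) 0 = 1" by simp
  ultimately have "to_fract (X * X_int b * P + Q) \<noteq> 0" and P: "?P \<noteq> 0" and Q: "?Q \<noteq> 0"
    by (metis poly_0 to_fract_eq_0_iff zero_neq_one)+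
  then have Q': "qvar * q_int qvar b * ?P + ?Q \<noteq> 0" by simp
  have frac: "A + B / (D / C) = (A * D + B * C) / D" if "D \<noteq> 0" for A B C D :: "int poly fract"
    using that by (simp add: field_simps)
  obtain c cs where as: "as = c # cs" using step by (cases as) auto
  have "q_cf (inverse qvar) (b # as) = q_int (inverse qvar) b + inverse qvar ^ b / (?P / ?Q)"
    using step by (simp add: as)
  also have "\<dots> = (qvar * q_int qvar b * ?P + ?Q) / (qvar ^ b * ?P)"
    unfolding q_int_inverse' using P Q by (simp add: field_simps power_inverse)
  finally have "q_cf qvar (a # b # as) =
      q_int qvar a + qvar ^ a / ((qvar * q_int qvar b * ?P + ?Q) / (qvar ^ b * ?P))"
    by (simp only: as q_cf.simps)
  also have "\<dots> = (q_int qvar a * (qvar * q_int qvar b * ?P + ?Q) + qvar ^ (a + b) * ?P) /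
      (qvar * q_int qvar b * ?P + ?Q)"
    unfolding frac[OF Q'] by (simp add: power_add mult.assoc)
  finally show ?case by (simp add: to_fract_power)
qed

lemma fold_sign_step_Minus:
  "fold sign_step (replicate a Minus) (u, v) = (qvar ^ a * u, v + q_int qvar a * u)"
  by (induction a arbitrary: u v) (simp_all add: q_int_Suc' algebra_simps)

lemma fold_sign_step_Plus:
  "fold sign_step (replicate b Plus) (u, v) = (u + q_int (inverse qvar) b * v, inverse qvar ^ b * v)"
  by (induction b arbitrary: u v) (simp_all add: q_int_Suc' algebra_simps)

definition even_index_sum :: "nat list \<Rightarrow> nat" where
  "even_index_sum as = (\<Sum>i=1..length as div 2. as ! (2 * i - 1))"

lemma even_index_sum_Nil [simp]: "even_index_sum [] = 0"
  by (simp add: even_index_sum_def)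

lemma even_index_sum_Cons_Cons [simp]: "even_index_sum (a # b # as) = b + even_index_sum as"
proof -
  have "even_index_sum (a # b # as) = (\<Sum>i=1..Suc (length as div 2). (a # b # as) ! (2 * i - 1))"
    by (simp add: even_index_sum_def)
  also have "\<dots> = b + (\<Sum>i=Suc 1..Suc (length as div 2). (a # b # as) ! (2 * i - 1))"
    by (subst sum.atLeast_Suc_atMost) simp_all
  also have "(\<Sum>i=Suc 1..Suc (length as div 2). (a # b # as) ! (2 * i - 1)) =
      (\<Sum>i=1..length as div 2. (a # b # as) ! (2 * Suc i - 1))"
    by (rule sum.shift_bounds_cl_Suc_ivl)
  also have "\<dots> = even_index_sum as"
    unfolding even_index_sum_def by (rule sum.cong) (auto simp: nth_Cons split: nat.splits)
  finally show ?thesis .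
qed

text \<open>The general start vector is needed for the induction, since processing the first two blocks
replaces \<open>(1, 0)\<close> by another vector. The sum of the even-indexed coefficients collects the powers of
\<open>q\<close> by which the blocks of sign \<open>Plus\<close> have to be scaled.\<close>
lemma fold_sign_step_eq_continuant_polys:
  assumes "\<forall>a\<in>set as. a \<ge> 1" "as \<noteq> []" "even (length as)"
  shows "case continuant_polys as of (P, Q) \<Rightarrow> even_index_sum as \<ge> 1 \<and>
    (\<forall>u v. qvar ^ (even_index_sum as - 1) * fst (fold sign_step (block_signs Minus as) (u, v)) =
      to_fract P * u + to_fract Q * v)"
  using assms
proof (induction rule: continuant_polys_induct)
  case (pair a b)
  obtain k where b: "b = Suc k" using pair by (cases b) auto
  have "qvar * (qvar ^ k * q_int (inverse qvar) b) = qvar * q_int qvar b"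
    using q_int_inverse[of b] by (simp add: b mult.assoc)
  then have inv: "qvar ^ k * q_int (inverse qvar) b = q_int qvar b" by simp
  have "qvar ^ (b - 1) * fst (fold sign_step (block_signs Minus [a, b]) (u, v)) =
      (q_int qvar a * q_int qvar b + qvar ^ (a + b - 1)) * u + q_int qvar b * v" for u v
  proof -
    have "fst (fold sign_step (block_signs Minus [a, b]) (u, v)) =
        qvar ^ a * u + q_int (inverse qvar) b * (v + q_int qvar a * u)"
      by (simp add: fold_sign_step_Minus fold_sign_step_Plus del: fold_replicate)
    then have "qvar ^ (b - 1) * fst (fold sign_step (block_signs Minus [a, b]) (u, v)) =
        qvar ^ k * qvar ^ a * u + (qvar ^ k * q_int (inverse qvar) b) * (v + q_int qvar a * u)"
      by (simp add: b distrib_left mult.assoc)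
    then show ?thesis unfolding inv by (simp add: b power_add algebra_simps)
  qed
  then show ?case using pair by (simp add: to_fract_power)
next
  case (step a b as P Q)
  let ?n = "even_index_sum as" and ?P = "to_fract P" and ?Q = "to_fract Q"
  have IH: "?n \<ge> 1" "\<And>u v. qvar ^ (?n - 1) * fst (fold sign_step (block_signs Minus as) (u, v)) = ?P * u + ?Q * v"
    using step by simp_all
  have exp: "b + ?n - 1 = b + (?n - 1)" using IH(1) by simp
  have "qvar ^ (b + ?n - 1) * fst (fold sign_step (block_signs Minus (a # b # as)) (u, v)) =
      (q_int qvar a * (qvar * q_int qvar b * ?P + ?Q) + qvar ^ (a + b) * ?P) * u +
      (qvar * q_int qvar b * ?P + ?Q) * v" for u v
  proof -
    \<comment> \<open>the second component after the block of \<open>a\<close> signs \<open>Minus\<close>\<close>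
    define t where "t = v + q_int qvar a * u"
    have "qvar ^ (b + ?n - 1) * fst (fold sign_step (block_signs Minus (a # b # as)) (u, v)) =
        qvar ^ b * (qvar ^ (?n - 1) * fst (fold sign_step (block_signs Minus as)
          (qvar ^ a * u + q_int (inverse qvar) b * t, inverse qvar ^ b * t)))"
      unfolding exp by (simp add: fold_sign_step_Minus fold_sign_step_Plus t_def power_add mult.assoc del: fold_replicate)
    also have "\<dots> = ?P * (qvar ^ (a + b) * u + (qvar ^ b * q_int (inverse qvar) b) * t) +
        ?Q * ((qvar ^ b * inverse qvar ^ b) * t)"
      unfolding IH(2) by (simp add: algebra_simps power_add)
    also have "\<dots> = ?P * (qvar ^ (a + b) * u + qvar * q_int qvar b * t) + ?Q * t"
      by (simp add: q_int_inverse power_inverse)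
    finally show ?thesis by (simp add: t_def algebra_simps)
  qed
  with IH(1) show ?case by (simp add: to_fract_power)
qed

section \<open>The snake graph of a rational number\<close>

text \<open>The axioms of a sign labelling force its values along the snake: by induction the south edge of box
\<open>t\<close> has sign \<open>south_sign t\<close>. Hence the sign of a shared edge tells whether it is an east or a north
edge, and the boxes are determined one after the other.\<close>
lemma is_snake_of_imp_snake_boxes:
  assumes "is_snake_of as bs"
  shows "bs = snake_boxes (butlast (cf_signs as))"
proof -
  from assms obtain \<sigma> e where snake: "is_snake bs" and lab: "sign_labelling bs \<sigma>"
    and seq: "sign_sequence bs \<sigma> e = cf_signs as"
    by (auto simp: is_snake_of_def)
  define ss where "ss = butlast (cf_signs as)"
  have ne: "bs \<noteq> []" using snake by (simp add: is_snake_def)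
  have ss: "ss = \<sigma> (south (hd bs)) #
      map (\<lambda>t. \<sigma> (shared_edge (bs ! t) (bs ! Suc t))) [0..<length bs - 1]"
    unfolding ss_def seq[symmetric] sign_sequence_def by (simp add: butlast_append)
  then have len: "length ss = length bs" using ne by simp
  have nth: "ss ! Suc t = \<sigma> (shared_edge (bs ! t) (bs ! Suc t))" if "Suc t < length bs" for t
    using that by (simp add: ss less_diff_conv)
  have box: "\<sigma> (north b) = \<sigma> (west b)" "\<sigma> (south b) = \<sigma> (east b)" "\<sigma> (north b) \<noteq> \<sigma> (south b)"
    if "b \<in> set bs" for b
    using lab that by (auto simp: sign_labelling_def)
  have "bs ! t = box_at ss t \<and> \<sigma> (south (bs ! t)) = south_sign t" if "t < length bs" for t
    using that
  proof (induction t)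
    case 0
    then show ?case
      using snake lab ne by (simp add: is_snake_def sign_labelling_def south_sign_def hd_conv_nth)
  next
    case (Suc t)
    then have IH: "bs ! t = box_at ss t" "\<sigma> (south (bs ! t)) = south_sign t" by auto
    have b: "bs ! t \<in> set bs" and b': "bs ! Suc t \<in> set bs" using Suc.prems by simp_all
    obtain x y where xy: "bs ! t = (x, y)" by (cases "bs ! t")
    with IH(1) have at_t: "box_at ss t = (x, y)" by simp
    have flip: "s = south_sign (Suc t)" if "s \<noteq> south_sign t" for s
      using that by (cases s) (auto simp: south_sign_def split: if_splits)
    show ?case
    proof (cases "attached_right (bs ! t) (bs ! Suc t)")
      case True
      then have next_box: "bs ! Suc t = (x + 1, y)" by (simp add: attached_right_def xy)
      have "ss ! Suc t = south_sign t"
        using nth[OF Suc.prems] True box(2)[OF b] IH(2) by (simp add: shared_edge_def)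
      moreover have "west (bs ! Suc t) = east (bs ! t)" by (simp add: next_box xy)
      then have "\<sigma> (south (bs ! Suc t)) \<noteq> south_sign t"
        using box[OF b'] box(2)[OF b] IH(2) by metis
      ultimately show ?thesis using flip[of "\<sigma> (south (bs ! Suc t))"] at_t next_box by simp
    next
      case False
      then have "attached_top (bs ! t) (bs ! Suc t)"
        using snake Suc.prems by (auto simp: is_snake_def)
      then have next_box: "bs ! Suc t = (x, y + 1)" by (simp add: attached_top_def xy)
      have sign: "ss ! Suc t \<noteq> south_sign t"
        using nth[OF Suc.prems] False box(3)[OF b] IH(2) by (simp add: shared_edge_def)
      have "south (bs ! Suc t) = north (bs ! t)" by (simp add: next_box xy)
      then have "\<sigma> (south (bs ! Suc t)) \<noteq> south_sign t"
        using box(3)[OF b] IH(2) by metis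
      with sign show ?thesis using flip[of "\<sigma> (south (bs ! Suc t))"] at_t next_box by simp
    qed
  qed
  then have "bs = snake_boxes ss"
    using len by (intro nth_equalityI) (simp_all add: snake_boxes_def)
  then show ?thesis by (simp add: ss_def)
qed

text \<open>A labelling of the whole grid that restricts to a sign labelling of every snake: in all boxes
with even coordinate sum the south and east edges are negative, in the others the north and west
edges. This is consistent because boxes sharing an edge have coordinate sums of different parity.\<close>
definition grid_sign :: "edge \<Rightarrow> edge_sign" where
  "grid_sign e =
     (if \<exists>x y. e = south (x, y) \<and> even (x + y) \<or> e = west (x, y) \<and> odd (x + y) then Minus else Plus)"

lemma grid_sign_south: "grid_sign (south (x, y)) = (if even (x + y) then Minus else Plus)"
  unfolding grid_sign_def by (simp add: unit_edge_simps del: south.simps west.simps)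

lemma grid_sign_west: "grid_sign (west (x, y)) = (if odd (x + y) then Minus else Plus)"
  unfolding grid_sign_def by (simp add: unit_edge_simps del: south.simps west.simps)

lemma grid_sign_box:
  "grid_sign (south b) = (if even (fst b + snd b) then Minus else Plus)"
  "grid_sign (east b) = (if even (fst b + snd b) then Minus else Plus)"
  "grid_sign (north b) = (if even (fst b + snd b) then Plus else Minus)"
  "grid_sign (west b) = (if even (fst b + snd b) then Plus else Minus)"
  by (cases b; simp add: grid_sign_south grid_sign_west north_eq_south east_eq_west
      del: south.simps west.simps north.simps east.simps)+

lemma sign_labelling_grid_sign: "hd bs = (0, 0) \<Longrightarrow> sign_labelling bs grid_sign"
  by (simp add: sign_labelling_def grid_sign_box del: south.simps west.simps north.simps east.simps)

lemma grid_sign_box_at: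
  "grid_sign (east (box_at ss t)) = south_sign t"
  "grid_sign (north (box_at ss t)) = opposite (south_sign t)"
  using box_at_sum[of ss t] by (simp_all add: grid_sign_box south_sign_def)

text \<open>The last sign \<open>s\<close> can be realized because the north and the east edge of the last box have
different signs.\<close>
lemma is_snake_of_snake_boxes:
  assumes signs: "cf_signs as = ss @ [s]" and ss: "ss \<noteq> []" "hd ss = Minus"
  shows "is_snake_of as (snake_boxes ss)"
  unfolding is_snake_of_def
proof (intro conjI exI)
  let ?bs = "snake_boxes ss"
  have len: "length ?bs = length ss" by (simp add: snake_boxes_def)
  have nth: "?bs ! t = box_at ss t" if "t < length ss" for t
    using that by (simp add: snake_boxes_def)
  have ne: "?bs \<noteq> []" using ss(1) len by auto
  have hd: "hd ?bs = (0, 0)" using nth[of 0] ss(1) ne by (simp add: hd_conv_nth)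
  have attached: "attached_right (box_at ss t) (box_at ss (Suc t)) \<longleftrightarrow> ss ! Suc t = south_sign t"
      "ss ! Suc t \<noteq> south_sign t \<Longrightarrow> attached_top (box_at ss t) (box_at ss (Suc t))" for t
    by (cases "box_at ss t"; simp add: attached_right_def attached_top_def)+
  show "is_snake ?bs"
    using ne hd attached nth by (simp add: is_snake_def len del: box_at.simps) metis
  show "sign_labelling ?bs grid_sign" using hd by (rule sign_labelling_grid_sign)
  let ?l = "box_at ss (length ss - 1)"
  let ?e = "if s = south_sign (length ss - 1) then east ?l else north ?l"
  have "last ?bs = ?l"
    using ss(1) ne nth[of "length ss - 1"] by (simp add: last_conv_nth len)
  then show "?e \<in> {north (last ?bs), east (last ?bs)}" by simp
  have other: "opposite u = v" if "v \<noteq> u" for u v using that by (cases u; cases v) auto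
  have last: "grid_sign ?e = s" using other[of s] by (simp add: grid_sign_box_at)
  have "ss = [grid_sign (south (hd ?bs))] @
      map (\<lambda>t. grid_sign (shared_edge (?bs ! t) (?bs ! Suc t))) [0..<length ?bs - 1]"
  proof (rule nth_equalityI)
    fix i assume i: "i < length ss"
    show "ss ! i = ([grid_sign (south (hd ?bs))] @
      map (\<lambda>t. grid_sign (shared_edge (?bs ! t) (?bs ! Suc t))) [0..<length ?bs - 1]) ! i"
    proof (cases i)
      case 0
      then show ?thesis
        using ss by (simp add: hd grid_sign_box hd_conv_nth del: south.simps)
    next
      case (Suc t)
      have "grid_sign (shared_edge (box_at ss t) (box_at ss (Suc t))) = ss ! Suc t"
        using other[of "ss ! Suc t"] by (simp add: shared_edge_def attached grid_sign_box_at del: box_at.simps)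
      then show ?thesis using i Suc by (simp add: len nth less_diff_conv del: box_at.simps)
    qed
  qed (use ss(1) in \<open>simp add: len\<close>)
  then show "sign_sequence ?bs grid_sign ?e = cf_signs as"
    unfolding sign_sequence_def signs last by simp
qed

text \<open>All expansions of \<open>x\<close> have the same signs up to the last one, and so the same snake.\<close>
lemma snake_graph_eq:
  assumes "cf_expansion x as" and signs: "cf_signs as = ss @ [s]" and ss: "ss \<noteq> []" "hd ss = Minus"
  shows "snake_graph x = snake_boxes ss"
  unfolding snake_graph_def
proof (rule the_equality)
  show "\<exists>as. cf_expansion x as \<and> is_snake_of as (snake_boxes ss)"
    using assms(1) is_snake_of_snake_boxes[OF signs ss] by blast
  fix bs assume "\<exists>as. cf_expansion x as \<and> is_snake_of as bs"
  then obtain as' where "cf_expansion x as'" "is_snake_of as' bs" by blast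
  then show "bs = snake_boxes ss"
    using is_snake_of_imp_snake_boxes butlast_cf_signs_unique[OF assms(1)] signs by fastforce
qed

lemma cf_signs_even_length:
  assumes "\<forall>a\<in>set as. a \<ge> 1" "as \<noteq> []" "even (length as)"
  obtains ss where "cf_signs as = ss @ [Plus]" "ss \<noteq> []" "hd ss = Minus"
proof -
  have "\<exists>ss. block_signs Minus as = ss @ [Plus] \<and> ss \<noteq> [] \<and> hd ss = Minus"
    using assms
  proof (induction as rule: continuant_polys.induct)
    case (1 a b as)
    obtain k where a: "a = Suc k" using 1 by (cases a) auto
    obtain l where b: "b = Suc l" using 1 by (cases b) auto
    show ?case
    proof (cases "as = []")
      case True
      have "block_signs Minus (a # b # as) = (Minus # replicate k Minus @ replicate l Plus) @ [Plus]"
        by (simp add: True a b replicate_append_same)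
      then show ?thesis by (metis list.distinct(1) list.sel(1))
    next
      case False
      with 1 obtain ss where "block_signs Minus as = ss @ [Plus]" by auto
      then have "block_signs Minus (a # b # as) =
          (Minus # replicate k Minus @ replicate b Plus @ ss) @ [Plus]"
        by (simp add: a)
      then show ?thesis by (metis list.distinct(1) list.sel(1))
    qed
  qed simp_all
  then show ?thesis using that by (auto simp: cf_signs_eq_block_signs)
qed

section \<open>The numerator of a \<open>q\<close>-rational\<close>

lemma monic_fraction_numerator_unique:
  fixes P Q R S :: "int poly"
  assumes "R * Q = P * S" "coprime P Q" "coprime R S" "lead_coeff P = 1" "lead_coeff R = 1"
  shows "R = P"
proof -
  have "R dvd P * S" using assms(1)[symmetric] by simp
  with assms(3) have "R dvd P" by (simp add: coprime_dvd_mult_left_iff)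
  then obtain c where c: "P = R * c" by (elim dvdE)
  have "P dvd R * Q" using assms(1) by simp
  with assms(2) have "P dvd R" by (simp add: coprime_dvd_mult_left_iff)
  have ne: "R \<noteq> 0" "P \<noteq> 0" using assms(4,5) by auto
  have "c \<noteq> 0" using c ne by (metis mult_zero_right)
  then have "degree P = degree R + degree c" using ne unfolding c by (simp add: degree_mult_eq)
  moreover have "degree P \<le> degree R" using \<open>P dvd R\<close> ne(1) by (rule dvd_imp_degree_le)
  ultimately have "degree c = 0" by simp
  moreover have "lead_coeff c = 1" using assms(4,5) unfolding c by (simp only: lead_coeff_mult mult_1_left)
  ultimately have "c = 1" by (elim degree_eq_zeroE) (simp add: one_pCons)
  with c show ?thesis by simp
qed

theorem theorem4p1:
  fixes x :: rat and R S :: "int poly" and as :: "nat list" and m n :: nat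
  assumes "x > 1"
    and "q_rational x = to_fract R / to_fract S"
    and "coprime R S"
    and "lead_coeff R = 1" and "lead_coeff S = 1"
    and "\<forall>c\<in>set (coeffs R). c \<ge> 0" and "\<forall>c\<in>set (coeffs S). c \<ge> 0"
    and "cf_expansion x as" and "length as = 2 * m"
    and "n = (\<Sum>i=1..m. as ! (2 * i - 1)) - 1"
  shows "to_fract R = qvar ^ n * matching_sum (snake_graph x)"
proof -
  have as: "\<forall>a\<in>set as. a \<ge> 1" "as \<noteq> []" "even (length as)"
    using assms(8,9) by (simp_all add: cf_expansion_def)
  obtain P Q where PQ: "continuant_polys as = (P, Q)" by fastforce
  have "Q \<noteq> 0" using continuant_polys_poly_0[OF as] PQ by auto
  moreover have "S \<noteq> 0" using assms(5) by auto
  moreover have "to_fract R / to_fract S = to_fract P / to_fract Q"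
    using q_cf_eq_continuant_polys[OF as] q_rational_eq[OF assms(8)] assms(2) PQ by simp
  ultimately have "to_fract (R * Q) = to_fract (P * S)"
    by (simp add: frac_eq_eq)
  then have "R * Q = P * S" by (simp only: to_fract_eq_iff)
  then have "R = P"
    using continuant_polys_coprime[OF as] continuant_polys_monic[OF as] PQ assms(3,4)
    by (intro monic_fraction_numerator_unique[of R Q P S]) simp_all
  obtain ss where signs: "cf_signs as = ss @ [Plus]" and ss: "ss \<noteq> []" "hd ss = Minus"
    using cf_signs_even_length[OF as] .
  have "n = even_index_sum as - 1"
    using assms(9,10) by (simp add: even_index_sum_def)
  then have "qvar ^ n * fst (fold sign_step (ss @ [Plus]) (1, 0)) = to_fract P"
    using fold_sign_step_eq_continuant_polys[OF as] PQ signs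
    by (simp add: cf_signs_eq_block_signs)
  moreover have "matching_sum (snake_graph x) = fst (fold sign_step (ss @ [Plus]) (1, 0))"
    using snake_graph_eq[OF assms(8) signs ss] matching_sum_snake_boxes[of ss] ss
    by (simp add: hd_conv_nth)
  ultimately show ?thesis using \<open>R = P\<close> by simp
qed

end
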